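(* Let $\mathcal H$ be an infinite dimensional complex Hilbert space, let $A$ be a bounded linear operator on $\mathcal H$, and suppose there are $\mu,\nu\in\mathbb C$ such that $A^2-2\mu A-\nu I=0$. Suppose that both eigenvalues $\lambda_{1,2}=\mu\pm\sqrt{\mu^2+\nu}$ of $A$ have infinite multiplicity. Let $s_0=\|A-\mu I\|_{\rm ess}$ be the essential norm of $A-\mu I$. Then the essential numerical range $W_{\rm ess}(A)$ is the closed elliptical disc with foci $\lambda_1,\lambda_2$, with major axis of length $s_0+|\mu^2+\nu|s_0^{-1}$ and minor axis of length $s_0-|\mu^2+\nu|s_0^{-1}$. In the case $s_0=0$ (where necessarily $\mu^2+\nu=0$) the expression $|\mu^2+\nu|s_0^{-1}$ is interpreted as $0$.
   Context: The numerical range of a bounded operator $B$ on $\mathcal H$ is $W(B)=\{\langle Bx,x\rangle : x\in\mathcal H,\ \|x\|=1\}$. The essential numerical range is $W_{\rm ess}(A)=\bigcap_K \operatorname{cl} W(A+K)$, where the intersection is over all compact operators $K$ on $\mathcal H$ and $\operatorname{cl}$ denotes topological closure. The essential norm is $\|B\|_{\rm ess}=\inf\{\|B+K\| : K \text{ compact}\}$. Eigenvalue $\lambda_j$ has infinite multiplicity if $\ker(A-\lambda_j I)$ is infinite dimensional (the case $\lambda_1=\lambda_2$ is allowed). The lengths of the axes are full lengths (not semi-axes). Elliptical discs may be degenerate: if the minor axis has length $0$, the closed disc is the closed line segment joining the foci, and if both axes have length $0$, it is a single point. *)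

theory Defs
  imports "HOL-Analysis.Analysis"
begin

section \<open>Complex Hilbert spaces\<close>

class complex_vector = real_vector +
  fixes scaleC :: "complex \<Rightarrow> 'a \<Rightarrow> 'a"  (infixr "*\<^sub>C" 75)
  assumes scaleC_add_right: "c *\<^sub>C (x + y) = c *\<^sub>C x + c *\<^sub>C y"
    and scaleC_add_left: "(c + d) *\<^sub>C x = c *\<^sub>C x + d *\<^sub>C x"
    and scaleC_scaleC: "c *\<^sub>C d *\<^sub>C x = (c * d) *\<^sub>C x"
    and scaleC_one: "1 *\<^sub>C x = x"
    and scaleR_scaleC: "r *\<^sub>R x = complex_of_real r *\<^sub>C x"

global_interpretation complex_vector: vector_space "scaleC :: complex \<Rightarrow> 'a \<Rightarrow> 'a::complex_vector"
  defines cspan = complex_vector.span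
  by unfold_locales (simp_all add: scaleC_add_right scaleC_add_left scaleC_scaleC scaleC_one)

text \<open>The inner product is linear in the first argument. That the inner product of a vector
  with itself is real follows from conjugate symmetry; definiteness follows from the last axiom.\<close>

class complex_inner = complex_vector + real_normed_vector +
  fixes cinner :: "'a \<Rightarrow> 'a \<Rightarrow> complex"
  assumes cinner_commute: "cinner x y = cnj (cinner y x)"
    and cinner_add_left: "cinner (x + y) z = cinner x z + cinner y z"
    and cinner_scaleC_left: "cinner (c *\<^sub>C x) y = c * cinner x y"
    and cinner_ge_zero: "0 \<le> Re (cinner x x)"
    and norm_eq_sqrt_cinner: "norm x = sqrt (Re (cinner x x))"

class chilbert_space = complex_inner + complete_space

definition infinite_dimensional :: "'a::complex_vector set \<Rightarrow> bool" where
  "infinite_dimensional S \<longleftrightarrow> \<not> (\<exists>B. finite B \<and> S \<subseteq> cspan B)"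


section \<open>Operators\<close>

definition bounded_clinear :: "('a::complex_inner \<Rightarrow> 'b::complex_inner) \<Rightarrow> bool" where
  "bounded_clinear f \<longleftrightarrow> bounded_linear f \<and> (\<forall>c x. f (c *\<^sub>C x) = c *\<^sub>C f x)"

definition compact_operator :: "('a::complex_inner \<Rightarrow> 'b::complex_inner) \<Rightarrow> bool" where
  "compact_operator K \<longleftrightarrow> bounded_clinear K \<and> compact (closure (K ` cball 0 1))"

definition eigenspace :: "('a::complex_vector \<Rightarrow> 'a) \<Rightarrow> complex \<Rightarrow> 'a set" where
  "eigenspace A l = {x. A x - l *\<^sub>C x = 0}"

definition numerical_range :: "('a::complex_inner \<Rightarrow> 'a) \<Rightarrow> complex set" where
  "numerical_range B = {cinner (B x) x | x. norm x = 1}"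

definition essential_numerical_range :: "('a::complex_inner \<Rightarrow> 'a) \<Rightarrow> complex set" where
  "essential_numerical_range A =
     (\<Inter>K \<in> {K. compact_operator K}. closure (numerical_range (\<lambda>x. A x + K x)))"

definition essential_norm :: "('a::complex_inner \<Rightarrow> 'b::complex_inner) \<Rightarrow> real" where
  "essential_norm B = Inf {onorm (\<lambda>x. B x + K x) | K. compact_operator K}"


section \<open>Elliptical discs\<close>

text \<open>\<open>E\<close> is the closed elliptical disc with foci \<open>p\<close>, \<open>q\<close>, major axis of full length \<open>M\<close> and
  minor axis of full length \<open>m\<close>. For \<open>m = 0\<close> it is the closed segment between the foci,
  for \<open>M = m = 0\<close> a single point. The lemma below recovers the two axes from this focal
  description, degenerate cases included.\<close>

definition is_elliptical_disc ::
  "complex set \<Rightarrow> complex \<Rightarrow> complex \<Rightarrow> real \<Rightarrow> real \<Rightarrow> bool" where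
  "is_elliptical_disc E p q M m \<longleftrightarrow>
     0 \<le> m \<and> 0 \<le> M \<and> M\<^sup>2 = m\<^sup>2 + (dist p q)\<^sup>2 \<and> E = {z. dist z p + dist z q \<le> M}"

lemma focal_sum_axes:
  fixes a b f x y :: real
  assumes "0 \<le> b" "0 \<le> a" "0 \<le> f" and ab: "a\<^sup>2 = b\<^sup>2 + f\<^sup>2"
  shows "cmod (Complex x y - of_real f) + cmod (Complex x y + of_real f) \<le> 2 * a \<longleftrightarrow>
    (\<exists>s t. s\<^sup>2 + t\<^sup>2 \<le> 1 \<and> x = a * s \<and> y = b * t)" (is "?L \<longleftrightarrow> ?R")
proof
  have fa: "f \<le> a"
    using ab assms by (auto intro: power2_le_imp_le[of f a])
  have n1: "(cmod (Complex x y - of_real f))\<^sup>2 = (x - f)\<^sup>2 + y\<^sup>2"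
    and n2: "(cmod (Complex x y + of_real f))\<^sup>2 = (x + f)\<^sup>2 + y\<^sup>2" for x y
    by (simp_all add: cmod_power2)
  {
    assume ?R
    then obtain s t where st: "s\<^sup>2 + t\<^sup>2 \<le> 1" "x = a * s" "y = b * t" by blast
    have "s\<^sup>2 \<le> 1" using st(1) zero_le_power2[of t] by linarith
    then have "\<bar>s\<bar> \<le> 1" by (simp add: abs_square_le_1)
    then have "\<bar>f * s\<bar> \<le> a"
      using fa \<open>0 \<le> f\<close> mult_mono[of f a "\<bar>s\<bar>" 1] by (simp add: abs_mult)
    then have le: "0 \<le> a - f * s" "0 \<le> a + f * s" by linarith+
    have "b\<^sup>2 * t\<^sup>2 \<le> b\<^sup>2 * (1 - s\<^sup>2)"
      using st(1) by (intro mult_left_mono) auto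
    moreover have "a\<^sup>2 * s\<^sup>2 = b\<^sup>2 * s\<^sup>2 + f\<^sup>2 * s\<^sup>2"
      unfolding ab by (simp add: algebra_simps)
    ultimately have *: "(a * s)\<^sup>2 + f\<^sup>2 + (b * t)\<^sup>2 \<le> a\<^sup>2 + (f * s)\<^sup>2"
      using ab by (simp add: power_mult_distrib right_diff_distrib)
    have "(a * s - f)\<^sup>2 + y\<^sup>2 \<le> (a - f * s)\<^sup>2" "(a * s + f)\<^sup>2 + y\<^sup>2 \<le> (a + f * s)\<^sup>2"
      using * unfolding st(3) by (simp_all add: power2_diff power2_sum mult.commute mult.left_commute)
    then have "cmod (Complex x y - of_real f) \<le> a - f * s"
      "cmod (Complex x y + of_real f) \<le> a + f * s"
      using n1[of x y] n2[of x y] st(2) power2_le_imp_le[OF _ le(1)] power2_le_imp_le[OF _ le(2)]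
      by simp_all
    then show ?L by linarith
  }
  {
    assume L: ?L
    define d1 d2 where "d1 = cmod (Complex x y - of_real f)" and "d2 = cmod (Complex x y + of_real f)"
    have d: "d1 + d2 \<le> 2 * a" "0 \<le> d1" "0 \<le> d2" using L by (auto simp: d1_def d2_def)
    have "cmod (2 * Complex x y) \<le> d1 + d2"
      unfolding d1_def d2_def
      using norm_triangle_ineq[of "Complex x y - of_real f" "Complex x y + of_real f"] by simp
    then have xy: "cmod (Complex x y) \<le> a" using d by (simp add: norm_mult)
    have xa: "\<bar>x\<bar> \<le> a" "\<bar>y\<bar> \<le> a" using xy abs_Re_le_cmod[of "Complex x y"] abs_Im_le_cmod[of "Complex x y"] by auto
    have "d1\<^sup>2 \<le> (2 * a - d2)\<^sup>2" using d by (intro power_mono) auto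
    then have "4 * (a * d2) \<le> 4 * (a\<^sup>2 + f * x)"
      using n1[of x y] n2[of x y] unfolding d1_def[symmetric] d2_def[symmetric]
      by (simp add: power2_eq_square algebra_simps)
    then have "(a * d2)\<^sup>2 \<le> (a\<^sup>2 + f * x)\<^sup>2" using d assms by (intro power_mono) auto
    then have "a\<^sup>2 * ((x + f)\<^sup>2 + y\<^sup>2) \<le> (a\<^sup>2 + f * x)\<^sup>2"
      using n2[of x y] by (simp add: d2_def power_mult_distrib)
    then have "a\<^sup>2 * x\<^sup>2 + a\<^sup>2 * f\<^sup>2 + a\<^sup>2 * y\<^sup>2 \<le> a\<^sup>2 * a\<^sup>2 + f\<^sup>2 * x\<^sup>2"
      by (simp add: power2_eq_square algebra_simps)
    then have key: "b\<^sup>2 * x\<^sup>2 + a\<^sup>2 * y\<^sup>2 \<le> a\<^sup>2 * b\<^sup>2"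
      unfolding ab by (simp add: algebra_simps)
    consider "a = 0" | "a > 0" "b = 0" | "a > 0" "b > 0" using assms by linarith
    then show ?R
    proof cases
      case 1
      then show ?thesis using xa by (intro exI[of _ 0]) auto
    next
      case 2
      then have "y = 0" using key by (simp add: mult_le_0_iff)
      moreover have "(x / a)\<^sup>2 \<le> 1" using xa 2 by (simp add: abs_square_le_1)
      ultimately show ?thesis using 2 by (intro exI[of _ "x / a"] exI[of _ 0]) auto
    next
      case 3
      then have "(x / a)\<^sup>2 + (y / b)\<^sup>2 = (b\<^sup>2 * x\<^sup>2 + a\<^sup>2 * y\<^sup>2) / (a\<^sup>2 * b\<^sup>2)"
        by (simp add: field_simps)
      also have "\<dots> \<le> 1" using key 3 by simp
      finally show ?thesis using 3 by (intro exI[of _ "x / a"] exI[of _ "y / b"]) auto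
    qed
  }
qed

lemma is_elliptical_disc_axes:
  assumes "is_elliptical_disc E p q M m" and u: "cmod u = 1" "p - q = of_real (dist p q) * u"
  shows "E = {(p + q) / 2 + u * Complex (M / 2 * s) (m / 2 * t) | s t. s\<^sup>2 + t\<^sup>2 \<le> 1}"
proof -
  have E: "0 \<le> m" "0 \<le> M" "M\<^sup>2 = m\<^sup>2 + (dist p q)\<^sup>2" "E = {z. dist z p + dist z q \<le> M}"
    using assms(1) by (auto simp: is_elliptical_disc_def)
  define f where "f = dist p q / 2"
  have uf: "u * of_real f = (p - q) / 2"
    unfolding u(2) f_def by simp
  have u0: "u \<noteq> 0" using u(1) by auto
  have iff: "(p + q) / 2 + u * Complex x y \<in> E \<longleftrightarrow>
      (\<exists>s t. s\<^sup>2 + t\<^sup>2 \<le> 1 \<and> x = M / 2 * s \<and> y = m / 2 * t)" for x y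
  proof -
    have "(p + q) / 2 + u * Complex x y - p = u * (Complex x y - of_real f)"
      "(p + q) / 2 + u * Complex x y - q = u * (Complex x y + of_real f)"
      unfolding right_diff_distrib distrib_left uf by (simp_all add: add_divide_distrib diff_divide_distrib)
    then have "dist ((p + q) / 2 + u * Complex x y) p = cmod (Complex x y - of_real f)"
      "dist ((p + q) / 2 + u * Complex x y) q = cmod (Complex x y + of_real f)"
      by (simp_all add: dist_norm norm_mult u(1))
    moreover have "(M / 2)\<^sup>2 = (m / 2)\<^sup>2 + f\<^sup>2"
      using E(3) by (simp add: f_def power_divide)
    ultimately show ?thesis
      using focal_sum_axes[of "m / 2" "M / 2" f x y] E by (simp add: f_def)
  qed
  show ?thesis
  proof (intro set_eqI iffI)
    fix z
    assume z: "z \<in> E"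
    define w where "w = (z - (p + q) / 2) / u"
    have zw: "z = (p + q) / 2 + u * Complex (Re w) (Im w)" using u0 by (simp add: w_def)
    then obtain s t where st: "s\<^sup>2 + t\<^sup>2 \<le> 1" "Re w = M / 2 * s" "Im w = m / 2 * t"
      using z iff[of "Re w" "Im w"] unfolding zw[symmetric] by blast
    have "z = (p + q) / 2 + u * Complex (M / 2 * s) (m / 2 * t)"
      unfolding st(2,3)[symmetric] by (fact zw)
    with st(1) show
      "z \<in> {(p + q) / 2 + u * Complex (M / 2 * s) (m / 2 * t) | s t. s\<^sup>2 + t\<^sup>2 \<le> 1}"
      by blast
  next
    fix z
    assume "z \<in> {(p + q) / 2 + u * Complex (M / 2 * s) (m / 2 * t) | s t. s\<^sup>2 + t\<^sup>2 \<le> 1}"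
    then obtain s t where "s\<^sup>2 + t\<^sup>2 \<le> 1"
      and z: "z = (p + q) / 2 + u * Complex (M / 2 * s) (m / 2 * t)"
      by blast
    then show "z \<in> E"
      unfolding z iff by blast
  qed
qed

end

theory Submission
  imports Defs
begin

text \<open>
  Put \<open>B = A - \<mu>\<close> and let \<open>\<sigma>\<close> be a square root of \<open>\<mu>\<^sup>2 + \<nu>\<close>, so that \<open>B\<^sup>2 = \<sigma>\<^sup>2\<close> and the
  two eigenvalues of \<open>B\<close> are \<open>\<sigma>\<close> and \<open>- \<sigma>\<close>. Translation by \<open>\<mu>\<close> reduces the claim to the
  identity \<open>essential_numerical_range_square_scalar\<close>: a point \<open>z\<close> is in the essential numerical
  range of \<open>B\<close> iff the sum of its distances to \<open>\<sigma>\<close> and \<open>- \<sigma>\<close> is at most \<open>s + |\<sigma>|\<^sup>2 / s\<close>, where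
  \<open>s\<close> is the essential norm.

  Since \<open>B\<^sup>2\<close> is a scalar, every vector \<open>x\<close> lies in the invariant subspace spanned by \<open>x\<close> and
  \<open>B x\<close>. If the two are independent, \<open>B\<close> acts there as a two-by-two matrix with eigenvalues \<open>\<sigma>\<close>
  and \<open>- \<sigma>\<close>, whose numerical range is an elliptical disc with these foci, and the norm of that
  matrix determines the axes.
  Both inclusions apply this to vectors on which a given compact operator is almost zero. Such
  vectors are plentiful: \<open>compact_operator_small_on_perp\<close> says that a compact operator is
  uniformly small on the orthogonal complement of a suitable finite set.

  \<^item> Upper bound. Let \<open>K\<close> be compact with \<open>B + K\<close> of norm at most \<open>s'\<close>, where \<open>s' > s\<close>. If \<open>x\<close> is a
  unit vector for which \<open>K x\<close> and \<open>K (B x)\<close> are small, then \<open>B\<close> is bounded by almost \<open>s'\<close> on the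
  span of \<open>x\<close> and \<open>B x\<close>. Testing this on the single vector \<open>a x + B x\<close> with \<open>|a| = s'\<close> gives
  an inequality for \<open>z = \<langle>B x, x\<rangle>\<close> from which \<open>\<parallel>B x\<parallel>\<close> cancels and which is the equation of
  the ellipse for \<open>s'\<close> (\<open>square_root_operator_estimate\<close>, \<open>focal_sum_le_of_conj_bound\<close>).
  Compressing \<open>B\<close> to the complement of a finite set is a compact perturbation, so it suffices
  to control \<open>\<langle>B y, y\<rangle>\<close> on this complement (\<open>essential_numerical_range_subset_perp\<close>).

  \<^item> Lower bound. If \<open>|\<sigma>| < s' < s\<close>, some unit vector \<open>u\<close> in the complement satisfies
  \<open>\<parallel>B u\<parallel> > s'\<close>. In the span of \<open>u\<close> and \<open>B u\<close> the operator is upper triangular with a corner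
  entry of modulus at least \<open>s' - |\<sigma>|\<^sup>2 / s'\<close>, so the ellipse for \<open>s'\<close> is covered
  (\<open>triangular_block_of_large_vector\<close>, \<open>triangular_block_numerical_range\<close>). If \<open>s = |\<sigma>|\<close>, the
  ellipse is the segment from \<open>- \<sigma>\<close> to \<open>\<sigma>\<close>, and pairs of orthogonal eigenvectors produce it.

  The infinite multiplicity of the eigenvalue \<open>\<sigma>\<close> gives \<open>|\<sigma>| \<le> s\<close>; the segment in the case of
  equality uses that of both eigenvalues.
\<close>

section \<open>Complex inner product spaces\<close>

lemma cinner_zero_left [simp]: "cinner (0::'a::complex_inner) y = 0"
  using cinner_add_left[of 0 0 y] by simp

lemma cinner_zero_right [simp]: "cinner x (0::'a::complex_inner) = 0"
  by (subst cinner_commute) simp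

lemma cinner_add_right: "cinner x (y + z :: 'a::complex_inner) = cinner x y + cinner x z"
  by (metis cinner_add_left cinner_commute complex_cnj_add)

lemma cinner_scaleC_right: "cinner x (c *\<^sub>C y :: 'a::complex_inner) = cnj c * cinner x y"
  by (metis cinner_scaleC_left cinner_commute complex_cnj_mult)

lemma cinner_minus_left: "cinner (- x :: 'a::complex_inner) y = - cinner x y"
  using cinner_add_left[of x "- x" y] by (simp add: add_eq_0_iff)

lemma cinner_minus_right: "cinner x (- y :: 'a::complex_inner) = - cinner x y"
  using cinner_add_right[of x y "- y"] by (simp add: add_eq_0_iff)

lemma cinner_diff_left: "cinner (x - y :: 'a::complex_inner) z = cinner x z - cinner y z"
  using cinner_add_left[of x "- y" z] by (simp add: cinner_minus_left)

lemma cinner_diff_right: "cinner x (y - z :: 'a::complex_inner) = cinner x y - cinner x z"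
  using cinner_add_right[of x y "- z"] by (simp add: cinner_minus_right)

lemma cinner_sum_left: "cinner (\<Sum>i\<in>I. f i :: 'a::complex_inner) y = (\<Sum>i\<in>I. cinner (f i) y)"
  by (induction I rule: infinite_finite_induct) (auto simp: cinner_add_left)

lemma cinner_sum_right: "cinner x (\<Sum>i\<in>I. f i :: 'a::complex_inner) = (\<Sum>i\<in>I. cinner x (f i))"
  by (induction I rule: infinite_finite_induct) (auto simp: cinner_add_right)

lemmas cinner_simps = cinner_add_left cinner_add_right cinner_diff_left cinner_diff_right
  cinner_scaleC_left cinner_scaleC_right cinner_minus_left cinner_minus_right

lemma cinner_self: "cinner x (x::'a::complex_inner) = complex_of_real ((norm x)\<^sup>2)"
proof -
  have "Im (cinner x x) = 0"
    using cinner_commute[of x x] by (metis Im_complex_of_real Reals_cnj_iff of_real_Re)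
  moreover have "(norm x)\<^sup>2 = Re (cinner x x)"
    using cinner_ge_zero[of x] by (simp add: norm_eq_sqrt_cinner)
  ultimately show ?thesis by (simp add: complex_eq_iff)
qed

lemma norm_scaleC: "norm (c *\<^sub>C x :: 'a::complex_inner) = cmod c * norm x"
proof -
  have "complex_of_real ((norm (c *\<^sub>C x))\<^sup>2) = c * cnj c * cinner x x"
    unfolding cinner_self[symmetric] by (simp add: cinner_simps)
  also have "\<dots> = complex_of_real ((cmod c * norm x)\<^sup>2)"
    by (simp add: cinner_self complex_norm_square[symmetric] power_mult_distrib)
  finally have "(norm (c *\<^sub>C x))\<^sup>2 = (cmod c * norm x)\<^sup>2" by (simp only: of_real_eq_iff)
  then show ?thesis by (rule power2_eq_imp_eq) auto
qed

lemma norm_add_square: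
  "(norm (x + y :: 'a::complex_inner))\<^sup>2 = (norm x)\<^sup>2 + 2 * Re (cinner x y) + (norm y)\<^sup>2"
proof -
  have "complex_of_real ((norm (x + y))\<^sup>2) = cinner x x + (cinner x y + cinner y x) + cinner y y"
    unfolding cinner_self[symmetric] by (simp add: cinner_simps)
  also have "cinner x y + cinner y x = complex_of_real (2 * Re (cinner x y))"
    by (subst (2) cinner_commute) (simp add: complex_add_cnj)
  finally have "complex_of_real ((norm (x + y))\<^sup>2)
      = complex_of_real ((norm x)\<^sup>2 + 2 * Re (cinner x y) + (norm y)\<^sup>2)"
    by (simp add: cinner_self)
  then show ?thesis by (simp only: of_real_eq_iff)
qed

lemma norm_add_square_orthogonal:
  "cinner x y = 0 \<Longrightarrow> (norm (x + y :: 'a::complex_inner))\<^sup>2 = (norm x)\<^sup>2 + (norm y)\<^sup>2"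
  by (simp add: norm_add_square)

lemma cinner_Cauchy_Schwarz: "cmod (cinner x y) \<le> norm (x::'a::complex_inner) * norm y"
proof (cases "y = 0")
  case False
  define c where "c = cinner x y / cinner y y"
  have yy: "cinner y y \<noteq> 0" using False by (simp add: cinner_self)
  have orth: "cinner (x - c *\<^sub>C y) (c *\<^sub>C y) = 0"
    using yy by (simp add: cinner_simps c_def)
  have "(norm x)\<^sup>2 = (norm (x - c *\<^sub>C y))\<^sup>2 + (norm (c *\<^sub>C y))\<^sup>2"
    using norm_add_square_orthogonal[OF orth] by simp
  then have "(norm (c *\<^sub>C y))\<^sup>2 \<le> (norm x)\<^sup>2" by simp
  then have "cmod c * norm y \<le> norm x"
    unfolding norm_scaleC by (rule power2_le_imp_le) simp
  moreover have "cmod c = cmod (cinner x y) / (norm y)\<^sup>2"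
    unfolding c_def norm_divide by (simp add: cinner_self norm_power)
  ultimately show ?thesis using False by (simp add: power2_eq_square field_simps)
qed simp

section \<open>Bounded and compact operators\<close>

lemma bounded_clinear_bounded_linear: "bounded_clinear f \<Longrightarrow> bounded_linear f"
  by (simp add: bounded_clinear_def)

lemma bounded_clinear_scaleC: "bounded_clinear f \<Longrightarrow> f (c *\<^sub>C x) = c *\<^sub>C f x"
  by (simp add: bounded_clinear_def)

lemma bounded_clinear_add: "bounded_clinear f \<Longrightarrow> f (x + y) = f x + f y"
  by (simp add: bounded_clinear_def linear_simps)

lemma bounded_clinear_diff: "bounded_clinear f \<Longrightarrow> f (x - y) = f x - f y"
  by (simp add: bounded_clinear_def linear_simps)

lemma bounded_clinear_bound:
  assumes "bounded_clinear f" obtains N where "N > 0" "\<And>x. norm (f x) \<le> N * norm x"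
  using bounded_linear.pos_bounded[OF bounded_clinear_bounded_linear[OF assms]]
  by (metis mult.commute)

lemma bounded_clinear_compose:
  "bounded_clinear f \<Longrightarrow> bounded_clinear g \<Longrightarrow> bounded_clinear (\<lambda>x. f (g x))"
  unfolding bounded_clinear_def by (auto intro: bounded_linear_compose)

lemma bounded_clinear_plus:
  "bounded_clinear f \<Longrightarrow> bounded_clinear g \<Longrightarrow> bounded_clinear (\<lambda>x. f x + g x)"
  unfolding bounded_clinear_def by (auto intro: bounded_linear_add simp: scaleC_add_right)

lemma bounded_clinear_scaleC_const: "bounded_clinear (\<lambda>x::'a::complex_inner. c *\<^sub>C x)"
  unfolding bounded_clinear_def
proof (intro conjI allI)
  show "bounded_linear (\<lambda>x::'a. c *\<^sub>C x)"
  proof (rule bounded_linear_intro[where K = "cmod c"])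
  qed (simp_all add: scaleC_add_right scaleR_scaleC scaleC_scaleC norm_scaleC mult.commute)
qed (simp add: scaleC_scaleC mult.commute)

lemma bounded_clinear_minus_scaleC:
  assumes "bounded_clinear (f :: 'a::complex_inner \<Rightarrow> 'a)"
  shows "bounded_clinear (\<lambda>x. f x - c *\<^sub>C x)"
  using bounded_clinear_plus[OF assms bounded_clinear_scaleC_const[of "- c"]] by simp

lemma compact_operatorI:
  assumes "bounded_clinear K" "compact C" "\<And>x. norm x \<le> 1 \<Longrightarrow> K x \<in> C"
  shows "compact_operator K"
proof -
  have "closure (K ` cball 0 1) \<subseteq> C"
    using assms(2,3) by (intro closure_minimal) (auto intro: compact_imp_closed)
  then have "compact (C \<inter> closure (K ` cball 0 1))"
    using assms(2) by (intro compact_Int_closed) auto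
  moreover have "C \<inter> closure (K ` cball 0 1) = closure (K ` cball 0 1)"
    using \<open>closure (K ` cball 0 1) \<subseteq> C\<close> by blast
  ultimately show ?thesis using assms(1) by (simp add: compact_operator_def)
qed

lemma compact_operator_bounded_clinear: "compact_operator K \<Longrightarrow> bounded_clinear K"
  by (simp add: compact_operator_def)

lemma compact_operator_in_closure:
  "norm x \<le> 1 \<Longrightarrow> K x \<in> closure (K ` cball 0 1)"
  by (intro subsetD[OF closure_subset]) auto

lemma compact_operator_zero:
  "compact_operator (\<lambda>x::'a::complex_inner. 0 :: 'b::complex_inner)"
  by (rule compact_operatorI[where C = "{0}"]) (auto simp: bounded_clinear_def)

lemma compact_operator_add:
  assumes "compact_operator K" "compact_operator L"
  shows "compact_operator (\<lambda>x. K x + L x)"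
proof (rule compact_operatorI)
  show "bounded_clinear (\<lambda>x. K x + L x)"
    using assms by (intro bounded_clinear_plus compact_operator_bounded_clinear)
  show "compact {x + y | x y. x \<in> closure (K ` cball 0 1) \<and> y \<in> closure (L ` cball 0 1)}"
    using assms by (intro compact_sums) (auto simp: compact_operator_def)
  show "K x + L x \<in> {x + y | x y. x \<in> closure (K ` cball 0 1) \<and> y \<in> closure (L ` cball 0 1)}"
    if "norm x \<le> 1" for x
    using compact_operator_in_closure[OF that] by blast
qed

lemma compact_operator_sum:
  assumes "\<And>i. i \<in> I \<Longrightarrow> compact_operator (K i)"
  shows "compact_operator (\<lambda>x. \<Sum>i\<in>I. K i x)"
  using assms
  by (induction I rule: infinite_finite_induct)
     (auto intro: compact_operator_zero compact_operator_add)

lemma compact_operator_compose_left: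
  assumes "bounded_clinear T" "compact_operator K"
  shows "compact_operator (\<lambda>x. T (K x))"
proof (rule compact_operatorI)
  show "bounded_clinear (\<lambda>x. T (K x))"
    by (rule bounded_clinear_compose[OF assms(1) compact_operator_bounded_clinear[OF assms(2)]])
  show "compact (T ` closure (K ` cball 0 1))"
    using assms
    by (intro compact_continuous_image linear_continuous_on bounded_clinear_bounded_linear)
       (auto simp: compact_operator_def)
  show "T (K x) \<in> T ` closure (K ` cball 0 1)" if "norm x \<le> 1" for x
    using compact_operator_in_closure[OF that] by blast
qed

text \<open>The inner operator maps the unit ball into a multiple of it, so a dilation of a compact set
  contains the image.\<close>

lemma compact_operator_compose_right:
  assumes "compact_operator K" "bounded_clinear T"
  shows "compact_operator (\<lambda>x. K (T x))"
proof -
  obtain N where N: "N > 0" "\<And>x. norm (T x) \<le> N * norm x"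
    using bounded_clinear_bound[OF assms(2)] by blast
  have K: "bounded_clinear K" using assms(1) by (rule compact_operator_bounded_clinear)
  show ?thesis
  proof (rule compact_operatorI)
    show "bounded_clinear (\<lambda>x. K (T x))"
      by (rule bounded_clinear_compose[OF K assms(2)])
    show "compact ((*\<^sub>R) N ` closure (K ` cball 0 1))"
      using assms by (intro compact_scaling) (auto simp: compact_operator_def)
    show "K (T x) \<in> (*\<^sub>R) N ` closure (K ` cball 0 1)" if "norm x \<le> 1" for x
    proof
      have "norm (T x) \<le> N"
        using order_trans[OF N(2)[of x] mult_left_mono[OF that, of N]] N(1) by simp
      then have "norm ((1 / N) *\<^sub>R T x) \<le> 1" using N(1) by (simp add: field_simps)
      then show "K ((1 / N) *\<^sub>R T x) \<in> closure (K ` cball 0 1)"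
        by (rule compact_operator_in_closure)
      show "K (T x) = N *\<^sub>R K ((1 / N) *\<^sub>R T x)"
        using N(1) K by (simp add: bounded_clinear_def linear_simps)
    qed
  qed
qed

text \<open>The image of the unit ball is contained in the image of a closed disc of scalars under the
  continuous map \<open>c \<mapsto> c v\<close>.\<close>

lemma compact_operator_rank_one:
  "compact_operator (\<lambda>x::'a::complex_inner. cinner x v *\<^sub>C v)"
proof (rule compact_operatorI)
  show "bounded_clinear (\<lambda>x. cinner x v *\<^sub>C v)"
    unfolding bounded_clinear_def
  proof (intro conjI allI)
    show "bounded_linear (\<lambda>x. cinner x v *\<^sub>C v)"
    proof (rule bounded_linear_intro[where K = "norm v * norm v"])
      show "norm (cinner x v *\<^sub>C v) \<le> norm x * (norm v * norm v)" for x
        using mult_right_mono[OF cinner_Cauchy_Schwarz[of x v], of "norm v"]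
        by (simp add: norm_scaleC mult.assoc)
    qed (simp_all add: cinner_simps scaleC_add_left scaleR_scaleC scaleC_scaleC)
  qed (simp add: cinner_simps scaleC_scaleC)
  have "continuous_on UNIV (\<lambda>c::complex. c *\<^sub>C v)"
  proof (intro linear_continuous_on bounded_linear_intro[where K = "norm v"])
  qed (simp_all add: scaleC_add_left scaleR_scaleC scaleC_scaleC norm_scaleC scaleR_conv_of_real)
  then show "compact ((\<lambda>c. c *\<^sub>C v) ` cball 0 (norm v))"
    by (intro compact_continuous_image) (auto intro: continuous_on_subset)
  show "cinner x v *\<^sub>C v \<in> (\<lambda>c. c *\<^sub>C v) ` cball 0 (norm v)" if "norm x \<le> 1" for x
    using cinner_Cauchy_Schwarz[of x v] mult_right_mono[OF that, of "norm v"] by auto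
qed

section \<open>Finite orthonormal sets\<close>

text \<open>Finiteness is built in: the projection onto the span is then a finite sum.\<close>

definition orthonormal :: "'a::complex_inner set \<Rightarrow> bool" where
  "orthonormal F \<longleftrightarrow> finite F \<and> (\<forall>e\<in>F. \<forall>f\<in>F. cinner e f = (if e = f then 1 else 0))"

definition perp :: "'a::complex_inner set \<Rightarrow> 'a set" where
  "perp F = {x. \<forall>f\<in>F. cinner x f = 0}"

definition proj :: "'a::complex_inner set \<Rightarrow> 'a \<Rightarrow> 'a" where
  "proj F x = (\<Sum>f\<in>F. cinner x f *\<^sub>C f)"

lemma perp_antimono: "F \<subseteq> G \<Longrightarrow> perp G \<subseteq> perp F"
  by (auto simp: perp_def)

lemma compact_operator_proj: "compact_operator (proj F)"
  unfolding proj_def[abs_def] by (intro compact_operator_sum compact_operator_rank_one)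

lemma orthonormal_insert:
  assumes "orthonormal F" "x \<in> perp F" "norm x = 1"
  shows "orthonormal (insert x F)"
proof -
  have "cinner x f = 0" "cinner f x = 0" if "f \<in> F" for f
    using that assms(2) cinner_commute[of f x] by (auto simp: perp_def)
  moreover have "x \<notin> F"
    using assms(2,3) cinner_self[of x] by (auto simp: perp_def)
  ultimately show ?thesis
    using assms by (auto simp: orthonormal_def cinner_self)
qed

lemma diff_proj_perp:
  assumes "orthonormal F"
  shows "x - proj F x \<in> perp F"
proof -
  have "cinner (proj F x) e = cinner x e" if "e \<in> F" for e
  proof -
    have "cinner (proj F x) e = (\<Sum>f\<in>F. if f = e then cinner x e else 0)"
      unfolding proj_def cinner_sum_left using assms that
      by (intro sum.cong) (auto simp: orthonormal_def cinner_simps)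
    then show ?thesis using assms that by (simp add: orthonormal_def)
  qed
  then show ?thesis by (simp add: perp_def cinner_simps)
qed

lemma cinner_perp_proj: "y \<in> perp F \<Longrightarrow> cinner y (proj F x) = 0"
  by (simp add: proj_def cinner_sum_right cinner_simps perp_def)

lemma norm_diff_proj_le:
  assumes "orthonormal F"
  shows "norm (x - proj F x) \<le> norm x"
proof -
  have "cinner (x - proj F x) (proj F x) = 0"
    using assms by (intro cinner_perp_proj diff_proj_perp)
  from norm_add_square_orthogonal[OF this]
  have "(norm (x - proj F x))\<^sup>2 \<le> (norm x)\<^sup>2" by simp
  then show ?thesis by (rule power2_le_imp_le) simp
qed

section \<open>Vectors orthogonal to a finite set\<close>

lemma norm_sum_orthonormal_sequence:
  fixes e :: "nat \<Rightarrow> 'a::complex_inner"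
  assumes "\<And>n. norm (e n) = 1" "\<And>m n. m < n \<Longrightarrow> cinner (e n) (e m) = 0"
  shows "(norm (\<Sum>i<N. e i))\<^sup>2 = real N"
proof (induction N)
  case (Suc N)
  have "cinner (e N) (\<Sum>i<N. e i) = 0"
    unfolding cinner_sum_right using assms(2) by (intro sum.neutral) auto
  then have "cinner (\<Sum>i<N. e i) (e N) = 0" by (subst cinner_commute) simp
  from norm_add_square_orthogonal[OF this] show ?case using Suc assms(1) by simp
qed simp

text \<open>Otherwise there is an orthonormal sequence along which \<open>\<parallel>K e\<parallel>\<close> stays above \<open>\<epsilon>\<close>; by compactness
  a subsequence of the images converges to some \<open>l\<close> with \<open>\<parallel>l\<parallel> \<ge> \<epsilon>\<close>. The sum of \<open>N\<close> late members
  has norm \<open>sqrt N\<close>, while its image is close to \<open>N l\<close> and so has norm of order \<open>N\<close>. This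
  contradicts boundedness. Prescribing a subset \<open>F\<^sub>0\<close> makes it possible to treat several compact
  operators in turn.\<close>

lemma compact_operator_small_on_perp:
  fixes K :: "'a::complex_inner \<Rightarrow> 'b::complex_inner"
  assumes K: "compact_operator K" and F0: "orthonormal F\<^sub>0" and "0 < \<epsilon>"
  obtains F where "orthonormal F" "F\<^sub>0 \<subseteq> F" "\<And>x. x \<in> perp F \<Longrightarrow> norm (K x) \<le> \<epsilon> * norm x"
proof -
  have bK: "bounded_clinear K" using K by (rule compact_operator_bounded_clinear)
  have "\<exists>F. orthonormal F \<and> F\<^sub>0 \<subseteq> F \<and> (\<forall>x\<in>perp F. norm (K x) \<le> \<epsilon> * norm x)"
  proof (rule ccontr)
    assume "\<not> ?thesis"
    then have neg: "\<exists>x\<in>perp F. norm (K x) > \<epsilon> * norm x" if "orthonormal F" "F\<^sub>0 \<subseteq> F" for F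
      using that by (meson not_le)
    have "\<exists>x\<in>perp F. norm x = 1 \<and> norm (K x) > \<epsilon>" if F: "orthonormal F" "F\<^sub>0 \<subseteq> F" for F
    proof -
      obtain x where x: "x \<in> perp F" "norm (K x) > \<epsilon> * norm x" using neg[OF F] by blast
      have "K 0 = 0" using bK by (simp add: bounded_clinear_def linear_simps)
      then have "x \<noteq> 0" using x(2) by auto
      define y where "y = complex_of_real (1 / norm x) *\<^sub>C x"
      have "y \<in> perp F" using x(1) by (simp add: y_def perp_def cinner_simps)
      moreover have "norm y = 1" using \<open>x \<noteq> 0\<close> by (simp add: y_def norm_scaleC norm_divide)
      moreover have "norm (K y) > \<epsilon>"
        using x(2) \<open>x \<noteq> 0\<close>
        by (simp add: y_def bounded_clinear_scaleC[OF bK] norm_scaleC norm_divide field_simps)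
      ultimately show ?thesis by blast
    qed
    then obtain g where g: "\<And>F. orthonormal F \<Longrightarrow> F\<^sub>0 \<subseteq> F \<Longrightarrow>
        g F \<in> perp F \<and> norm (g F) = 1 \<and> norm (K (g F)) > \<epsilon>"
      by metis
    \<comment> \<open>The orthonormal sequence, each member orthogonal to \<open>F\<^sub>0\<close> and to all earlier ones.\<close>
    define Fs where "Fs n = ((\<lambda>F. insert (g F) F) ^^ n) F\<^sub>0" for n
    define e where "e n = g (Fs n)" for n
    have Fs_Suc: "Fs (Suc n) = insert (e n) (Fs n)" for n by (simp add: Fs_def e_def)
    have Fs: "orthonormal (Fs n) \<and> F\<^sub>0 \<subseteq> Fs n" for n
    proof (induction n)
      case 0
      then show ?case using F0 by (simp add: Fs_def)
    next
      case (Suc n)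
      then show ?case using g[of "Fs n"] by (auto simp: Fs_Suc e_def intro: orthonormal_insert)
    qed
    have e: "e n \<in> perp (Fs n)" "norm (e n) = 1" "norm (K (e n)) > \<epsilon>" for n
      using g[of "Fs n"] Fs[of n] by (auto simp: e_def)
    have mem: "e m \<in> Fs n" if "m < n" for m n
      using that by (induction n) (auto simp: Fs_Suc less_Suc_eq)
    have orth: "cinner (e n) (e m) = 0" if "m < n" for m n
      using e(1)[of n] mem[OF that] by (auto simp: perp_def)
    have "seq_compact (closure (K ` cball 0 1))"
      using K by (simp add: compact_operator_def compact_eq_seq_compact_metric)
    then obtain l r where r: "strict_mono r" "((\<lambda>n. K (e n)) \<circ> r) \<longlonglongrightarrow> l"
      using compact_operator_in_closure[of "e _" K] e(2)
      unfolding seq_compact_def by (metis order_refl)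
    have "\<epsilon> \<le> norm l"
      using tendsto_norm[OF r(2)] e(3)
      by (intro LIMSEQ_le_const[of "\<lambda>n. norm (((\<lambda>n. K (e n)) \<circ> r) n)"]) (auto intro: less_imp_le)
    obtain n0 where n0: "\<And>n. n \<ge> n0 \<Longrightarrow> norm (K (e (r n)) - l) < \<epsilon> / 2"
      using LIMSEQ_D[OF r(2), of "\<epsilon> / 2"] \<open>0 < \<epsilon>\<close> by (auto simp: dist_norm)
    \<comment> \<open>The part of the subsequence whose images are within \<open>\<epsilon> / 2\<close> of the limit.\<close>
    define h where "h i = e (r (n0 + i))" for i
    have h: "norm (h i) = 1" "norm (K (h i) - l) \<le> \<epsilon> / 2"
      and h_orth: "j < i \<Longrightarrow> cinner (h i) (h j) = 0" for i j
      using e(2) n0[of "n0 + i"] orth r(1) by (auto simp: h_def strict_mono_less less_imp_le)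
    obtain C where C: "C > 0" "\<And>x. norm (K x) \<le> C * norm x"
      using bounded_clinear_bound[OF bK] by blast
    have bound: "real N * (\<epsilon> / 2) \<le> C * sqrt (real N)" for N
    proof -
      define v where "v = (\<Sum>i<N. h i)"
      have "norm v = sqrt (real N)"
        using norm_sum_orthonormal_sequence[of h N, OF h(1) h_orth] real_sqrt_unique
        by (metis norm_ge_zero v_def)
      have "K v = (\<Sum>i<N. K (h i))"
        unfolding v_def
        using linear_sum[OF bounded_linear.linear[OF bounded_clinear_bounded_linear[OF bK]]] .
      also have "\<dots> = (\<Sum>i<N. K (h i) - l) + real N *\<^sub>R l"
        by (simp add: sum_subtractf sum_constant_scaleR)
      finally have "real N *\<^sub>R l = K v - (\<Sum>i<N. K (h i) - l)" by simp
      then have "norm (real N *\<^sub>R l) \<le> norm (K v) + norm (\<Sum>i<N. K (h i) - l)"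
        by (metis norm_triangle_ineq4)
      moreover have "norm (\<Sum>i<N. K (h i) - l) \<le> real N * (\<epsilon> / 2)"
        using sum_norm_le[of "{..<N}" "\<lambda>i. K (h i) - l" "\<lambda>_. \<epsilon> / 2"] h(2) by simp
      moreover have "real N * \<epsilon> \<le> norm (real N *\<^sub>R l)"
        using \<open>\<epsilon> \<le> norm l\<close> by (simp add: mult_left_mono)
      moreover have "norm (K v) \<le> C * sqrt (real N)" using C(2)[of v] \<open>norm v = _\<close> by simp
      ultimately show ?thesis by (simp add: field_simps)
    qed
    obtain n where "2 * C / \<epsilon> < real n" using reals_Archimedean2 by blast
    then have "2 * C < real n * \<epsilon>" using \<open>0 < \<epsilon>\<close> by (simp add: field_simps)
    moreover have n: "0 < real n"
      using \<open>2 * C / \<epsilon> < real n\<close> C(1) \<open>0 < \<epsilon>\<close> by (smt (verit) divide_pos_pos)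
    ultimately have "real n * (2 * C) < real n * (real n * \<epsilon>)" by simp
    moreover have "real n * real n * \<epsilon> \<le> 2 * C * real n"
      using bound[of "n * n"] by (simp add: real_sqrt_mult)
    ultimately show False by (simp add: algebra_simps)
  qed
  then show ?thesis using that by blast
qed

text \<open>Each orthogonality condition cuts the dimension of the subspace by at most one: if \<open>w\<close> violates
  it, every vector differs from one satisfying it by a multiple of \<open>w\<close>. Hence finitely many
  conditions leave an infinite dimensional, in particular nonzero, subspace.\<close>

lemma infinite_dimensional_unit_perp:
  fixes S :: "'a::complex_inner set"
  assumes "infinite_dimensional S" "complex_vector.subspace S" "finite F"
  obtains x where "x \<in> S" "x \<in> perp F" "norm x = 1"
proof -
  have sub: "complex_vector.subspace (S \<inter> perp F)" for F
    using assms(2)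
    by (auto simp: complex_vector.subspace_def perp_def cinner_simps)
  have "infinite_dimensional (S \<inter> perp F)"
    using assms(3)
  proof (induction F rule: finite_induct)
    case empty
    then show ?case using assms(1) by (simp add: perp_def)
  next
    case (insert v F)
    show ?case
    proof (cases "\<exists>w\<in>S \<inter> perp F. cinner w v \<noteq> 0")
      case False
      then have "S \<inter> perp (insert v F) = S \<inter> perp F" by (auto simp: perp_def)
      then show ?thesis using insert.IH by simp
    next
      case True
      then obtain w where w: "w \<in> S \<inter> perp F" "cinner w v \<noteq> 0" by blast
      show ?thesis
        unfolding infinite_dimensional_def
      proof
        assume "\<exists>B. finite B \<and> S \<inter> perp (insert v F) \<subseteq> cspan B"
        then obtain B where B: "finite B" "S \<inter> perp (insert v F) \<subseteq> cspan B" by blast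
        have "S \<inter> perp F \<subseteq> cspan (insert w B)"
        proof
          fix x assume x: "x \<in> S \<inter> perp F"
          define c where "c = cinner x v / cinner w v"
          have "x - c *\<^sub>C w \<in> S \<inter> perp F"
            using sub[of F] x w(1)
            by (intro complex_vector.subspace_diff complex_vector.subspace_scale)
          moreover have "cinner (x - c *\<^sub>C w) v = 0"
            using w(2) by (simp add: cinner_simps c_def)
          ultimately have "x - c *\<^sub>C w \<in> cspan B" using B(2) by (auto simp: perp_def)
          then show "x \<in> cspan (insert w B)" by (auto simp: complex_vector.span_insert)
        qed
        then show False
          using insert.IH B(1) unfolding infinite_dimensional_def by blast
      qed
    qed
  qed
  then have "\<not> S \<inter> perp F \<subseteq> cspan {}" unfolding infinite_dimensional_def by blast
  then obtain y where y: "y \<in> S \<inter> perp F" "y \<noteq> 0" by auto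
  have "complex_of_real (1 / norm y) *\<^sub>C y \<in> S \<inter> perp F"
    using sub y(1) by (rule complex_vector.subspace_scale)
  moreover have "norm (complex_of_real (1 / norm y) *\<^sub>C y) = 1"
    using y(2) by (simp add: norm_scaleC norm_divide)
  ultimately show ?thesis using that by blast
qed

section \<open>Plane geometry of the ellipse\<close>

lemma complex_polar_unit:
  obtains u where "cmod u = 1" "z = of_real (cmod z) * u"
proof (cases "z = 0")
  case True
  then show ?thesis using that[of 1] by simp
next
  case False
  then show ?thesis using that[of "sgn z"] by (simp add: sgn_eq norm_divide)
qed

text \<open>Convexity of the focal sum along the ray from the centre, where its value is \<open>2 |\<sigma>|\<close>.\<close>

lemma focal_sum_scale:
  assumes "0 \<le> r" "r \<le> 1"
  shows "cmod (of_real r * z - \<sigma>) + cmod (of_real r * z + \<sigma>)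
    \<le> r * (cmod (z - \<sigma>) + cmod (z + \<sigma>)) + (1 - r) * (2 * cmod \<sigma>)"
proof -
  have n: "cmod (of_real r * w) = r * cmod w" "cmod (of_real (1 - r) * w) = (1 - r) * cmod w" for w
    using assms by (simp_all only: norm_mult norm_of_real abs_of_nonneg diff_ge_0_iff_ge)
  have "of_real r * z - \<sigma> = of_real r * (z - \<sigma>) - of_real (1 - r) * \<sigma>"
    "of_real r * z + \<sigma> = of_real r * (z + \<sigma>) + of_real (1 - r) * \<sigma>"
    by (simp_all add: algebra_simps)
  then have "cmod (of_real r * z - \<sigma>) \<le> r * cmod (z - \<sigma>) + (1 - r) * cmod \<sigma>"
    "cmod (of_real r * z + \<sigma>) \<le> r * cmod (z + \<sigma>) + (1 - r) * cmod \<sigma>"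
    using norm_triangle_ineq4[of "of_real r * (z - \<sigma>)" "of_real (1 - r) * \<sigma>"]
      norm_triangle_ineq[of "of_real r * (z + \<sigma>)" "of_real (1 - r) * \<sigma>"]
    unfolding n by simp_all
  then show ?thesis by (simp add: algebra_simps)
qed

lemma focal_distance_le_major_axis:
  fixes s f :: real assumes "0 < s" shows "2 * f \<le> s + f\<^sup>2 / s"
proof -
  have "0 \<le> (s - f)\<^sup>2 / s" using assms by simp
  also have "\<dots> = s + f\<^sup>2 / s - 2 * f"
    using assms by (simp add: field_simps power2_eq_square)
  finally show ?thesis by simp
qed

text \<open>Rotating by a unit number moves the foci to the real axis, which makes \<open>focal_sum_axes\<close>
  applicable.\<close>

lemma focal_sum_rotate:
  assumes "cmod u = 1" "\<sigma> = of_real f * u"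
  shows "cmod (u * w - \<sigma>) = cmod (w - of_real f)" "cmod (u * w + \<sigma>) = cmod (w + of_real f)"
proof -
  have "u * w - \<sigma> = u * (w - of_real f)" "u * w + \<sigma> = u * (w + of_real f)"
    by (simp_all add: assms(2) algebra_simps)
  then show "cmod (u * w - \<sigma>) = cmod (w - of_real f)"
    "cmod (u * w + \<sigma>) = cmod (w + of_real f)"
    by (simp_all add: norm_mult assms(1))
qed

text \<open>The boundary of the ellipse is the image of the circle \<open>|w| = s\<close> under the Joukowski map
  \<open>w \<mapsto> (w + \<sigma>\<^sup>2 / w) / 2\<close>. For a boundary point \<open>z\<close>, eliminating \<open>1 / w\<close> from this equation and
  its conjugate expresses \<open>s\<^sup>2 cnj z - (cnj \<sigma>)\<^sup>2 z\<close> as a real multiple of \<open>cnj w\<close>, hence with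
  constant modulus. With the foci on the real axis the bound is the equation of the ellipse with
  semi-axes \<open>(s\<^sup>2 \<plusminus> |\<sigma>|\<^sup>2) / (2 s)\<close>.\<close>

lemma focal_sum_le_of_conj_bound:
  assumes fs: "cmod \<sigma> < s"
    and le: "2 * s * cmod (of_real (s\<^sup>2) * cnj z - (cnj \<sigma>)\<^sup>2 * z) \<le> s ^ 4 - cmod \<sigma> ^ 4"
  shows "cmod (z - \<sigma>) + cmod (z + \<sigma>) \<le> s + (cmod \<sigma>)\<^sup>2 / s"
proof -
  define f where "f = cmod \<sigma>"
  have f: "0 \<le> f" "f < s" "0 < s" using fs norm_ge_zero[of \<sigma>] by (auto simp: f_def simp del: norm_ge_zero)
  have f2: "f\<^sup>2 < s\<^sup>2" using f by (intro power_strict_mono) auto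
  obtain u where u: "cmod u = 1" "\<sigma> = of_real f * u"
    using complex_polar_unit[of \<sigma>] by (auto simp: f_def)
  have uu: "u * cnj u = 1" using u(1) by (simp add: complex_norm_square[symmetric])
  define w where "w = cnj u * z"
  have z: "z = u * w" using uu by (simp add: w_def mult.assoc[symmetric])
  define x y where "x = Re w" and "y = Im w"
  have "of_real (s\<^sup>2) * cnj z - (cnj \<sigma>)\<^sup>2 * z
      = cnj u * (of_real (s\<^sup>2) * cnj w - of_real (f\<^sup>2) * (u * cnj u) * w)"
    by (simp add: z u(2) power2_eq_square algebra_simps)
  also have "\<dots> = cnj u * Complex (x * (s\<^sup>2 - f\<^sup>2)) (- (y * (s\<^sup>2 + f\<^sup>2)))"
    by (simp add: uu complex_eq_iff x_def y_def algebra_simps)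
  finally have "cmod (of_real (s\<^sup>2) * cnj z - (cnj \<sigma>)\<^sup>2 * z)
      = cmod (Complex (x * (s\<^sup>2 - f\<^sup>2)) (- (y * (s\<^sup>2 + f\<^sup>2))))"
    by (simp add: norm_mult u(1))
  then have "2 * s * cmod (Complex (x * (s\<^sup>2 - f\<^sup>2)) (- (y * (s\<^sup>2 + f\<^sup>2)))) \<le> s ^ 4 - f ^ 4"
    using le by (simp add: f_def)
  from power_mono[OF this, of 2]
  have "4 * s\<^sup>2 * ((x * (s\<^sup>2 - f\<^sup>2))\<^sup>2 + (y * (s\<^sup>2 + f\<^sup>2))\<^sup>2) \<le> (s ^ 4 - f ^ 4)\<^sup>2"
    using f by (simp add: power_mult_distrib cmod_power2)
  also have "s ^ 4 - f ^ 4 = (s\<^sup>2 - f\<^sup>2) * (s\<^sup>2 + f\<^sup>2)"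
    by (simp add: power4_eq_xxxx power2_eq_square algebra_simps)
  finally have key: "4 * s\<^sup>2 * ((x * (s\<^sup>2 - f\<^sup>2))\<^sup>2 + (y * (s\<^sup>2 + f\<^sup>2))\<^sup>2)
      \<le> ((s\<^sup>2 - f\<^sup>2) * (s\<^sup>2 + f\<^sup>2))\<^sup>2" .
  define p q where "p = s\<^sup>2 + f\<^sup>2" and "q = s\<^sup>2 - f\<^sup>2"
  have pq: "0 < p" "0 < q" using f2 f by (auto simp: p_def q_def intro: add_pos_nonneg)
  have key': "4 * s\<^sup>2 * ((x * q)\<^sup>2 + (y * p)\<^sup>2) \<le> (q * p)\<^sup>2"
    using key by (simp add: p_def q_def)
  define a b where "a = p / (2 * s)" and "b = q / (2 * s)"
  have ab: "0 < a" "0 < b" using pq f by (auto simp: a_def b_def)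
  have "(x / a)\<^sup>2 + (y / b)\<^sup>2 = 4 * s\<^sup>2 * ((x * q)\<^sup>2 + (y * p)\<^sup>2) / (q * p)\<^sup>2"
    using pq f by (simp add: a_def b_def field_simps)
  also have "\<dots> \<le> 1" using key' pq by simp
  finally have xy: "(x / a)\<^sup>2 + (y / b)\<^sup>2 \<le> 1" .
  have aeq: "a\<^sup>2 = b\<^sup>2 + f\<^sup>2"
    using f by (simp add: a_def b_def p_def q_def power_divide field_simps power2_eq_square)
  have "cmod (Complex x y - of_real f) + cmod (Complex x y + of_real f) \<le> 2 * a"
    using focal_sum_axes[of b a f x y] ab f aeq xy
    by (metis less_imp_le nonzero_mult_div_cancel_left order_less_irrefl times_divide_eq_right)
  moreover have "2 * a = s + f\<^sup>2 / s"
    using f by (simp add: a_def p_def field_simps power2_eq_square)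
  moreover have "Complex x y = w" by (simp add: x_def y_def)
  ultimately show ?thesis
    using focal_sum_rotate[OF u, of w] by (simp add: z f_def)
qed

text \<open>Scaling \<open>z\<close> by \<open>1 / \<rho>\<close> gives the exact bound. Moving back by \<open>(\<rho> - 1) |w|\<close> costs at most the
  factor \<open>\<rho>\<close>, because \<open>2 |w|\<close> is bounded by the focal sum at \<open>w\<close>.\<close>

lemma focal_sum_le_of_relaxed_conj_bound:
  assumes fs: "cmod \<sigma> < s" and "1 \<le> \<rho>"
    and le: "2 * s * cmod (of_real (s\<^sup>2) * cnj z - (cnj \<sigma>)\<^sup>2 * z) \<le> \<rho> * (s ^ 4 - cmod \<sigma> ^ 4)"
  shows "cmod (z - \<sigma>) + cmod (z + \<sigma>) \<le> \<rho> * (s + (cmod \<sigma>)\<^sup>2 / s)"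
proof -
  define w where "w = z / of_real \<rho>"
  have z: "z = of_real \<rho> * w" using assms(2) by (simp add: w_def)
  have "of_real (s\<^sup>2) * cnj z - (cnj \<sigma>)\<^sup>2 * z
      = of_real \<rho> * (of_real (s\<^sup>2) * cnj w - (cnj \<sigma>)\<^sup>2 * w)"
    by (simp add: z algebra_simps)
  then have "cmod (of_real (s\<^sup>2) * cnj z - (cnj \<sigma>)\<^sup>2 * z)
      = \<rho> * cmod (of_real (s\<^sup>2) * cnj w - (cnj \<sigma>)\<^sup>2 * w)"
    using assms(2) by (simp only: norm_mult norm_of_real)
  then have "\<rho> * (2 * s * cmod (of_real (s\<^sup>2) * cnj w - (cnj \<sigma>)\<^sup>2 * w))
      \<le> \<rho> * (s ^ 4 - cmod \<sigma> ^ 4)"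
    using le by (simp add: mult.left_commute)
  then have "2 * s * cmod (of_real (s\<^sup>2) * cnj w - (cnj \<sigma>)\<^sup>2 * w) \<le> s ^ 4 - cmod \<sigma> ^ 4"
    using assms(2) by (simp add: mult_le_cancel_left)
  from focal_sum_le_of_conj_bound[OF fs this]
  have w: "cmod (w - \<sigma>) + cmod (w + \<sigma>) \<le> s + (cmod \<sigma>)\<^sup>2 / s" .
  have "2 * cmod w \<le> cmod (w - \<sigma>) + cmod (w + \<sigma>)"
    using norm_triangle_ineq[of "w - \<sigma>" "w + \<sigma>"] by (simp add: norm_mult)
  then have "(\<rho> - 1) * (2 * cmod w) \<le> (\<rho> - 1) * (cmod (w - \<sigma>) + cmod (w + \<sigma>))"
    using assms(2) by (intro mult_left_mono) auto
  moreover have "cmod (z - w) = (\<rho> - 1) * cmod w"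
  proof -
    have "z - w = of_real (\<rho> - 1) * w" by (simp add: z algebra_simps)
    then show ?thesis using assms(2) by (simp only: norm_mult norm_of_real)
  qed
  moreover have "cmod (z - \<sigma>) \<le> cmod (w - \<sigma>) + cmod (z - w)"
    "cmod (z + \<sigma>) \<le> cmod (w + \<sigma>) + cmod (z - w)"
    using norm_triangle_ineq[of "w - \<sigma>" "z - w"] norm_triangle_ineq[of "w + \<sigma>" "z - w"]
    by (simp_all add: add.commute)
  ultimately have "cmod (z - \<sigma>) + cmod (z + \<sigma>) \<le> \<rho> * (cmod (w - \<sigma>) + cmod (w + \<sigma>))"
    by (simp add: algebra_simps)
  also have "\<dots> \<le> \<rho> * (s + (cmod \<sigma>)\<^sup>2 / s)"
    using w assms(2) by (intro mult_left_mono) auto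
  finally show ?thesis .
qed

text \<open>The filled ellipse is the union, over the points \<open>c \<sigma>\<close> of the segment between the foci, of
  circles with centre \<open>c \<sigma>\<close> and radius \<open>(k / 2) sqrt (1 - c\<^sup>2)\<close>; these circles are the images of the
  parallels of the Riemann sphere under the numerical range map of a block with corner entry \<open>k\<close>.
  The difference \<open>\<phi> c\<close> of the two sides is a quadratic polynomial in \<open>c\<close> that is nonnegative at
  \<open>1\<close> and nonpositive at its vertex \<open>c0\<close> when \<open>z\<close> is in the ellipse.\<close>

lemma ellipse_chord_parameter:
  assumes "0 \<le> k" and le: "cmod (z - \<sigma>) + cmod (z + \<sigma>) \<le> sqrt (k\<^sup>2 + 4 * (cmod \<sigma>)\<^sup>2)"
  obtains c where "-1 \<le> c" "c \<le> 1"
    "(cmod (z - of_real c * \<sigma>))\<^sup>2 = k\<^sup>2 / 4 * (1 - c\<^sup>2)"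
proof -
  define f where "f = cmod \<sigma>"
  obtain u where u: "cmod u = 1" "\<sigma> = of_real f * u"
    using complex_polar_unit[of \<sigma>] by (auto simp: f_def)
  have uu: "u * cnj u = 1" using u(1) by (simp add: complex_norm_square[symmetric])
  define w where "w = cnj u * z"
  have z: "z = u * w" using uu by (simp add: w_def mult.assoc[symmetric])
  define x y where "x = Re w" and "y = Im w"
  have w: "w = Complex x y" by (simp add: x_def y_def)
  define a b where "a = sqrt (k\<^sup>2 + 4 * f\<^sup>2) / 2" and "b = k / 2"
  have ab: "0 \<le> b" "0 \<le> a" "0 \<le> f" "a\<^sup>2 = b\<^sup>2 + f\<^sup>2"
    using assms(1) by (auto simp: a_def b_def f_def power_divide)
  have "cmod (Complex x y - of_real f) + cmod (Complex x y + of_real f) \<le> 2 * a"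
    using le focal_sum_rotate[OF u, of w] by (simp add: z w f_def a_def)
  then obtain S T where ST: "S\<^sup>2 + T\<^sup>2 \<le> 1" "x = a * S" "y = b * T"
    using focal_sum_axes[OF ab] by blast
  define \<phi> where "\<phi> c = (x - c * f)\<^sup>2 + y\<^sup>2 - b\<^sup>2 * (1 - c\<^sup>2)" for c
  have \<phi>: "(cmod (z - of_real c * \<sigma>))\<^sup>2 - k\<^sup>2 / 4 * (1 - c\<^sup>2) = \<phi> c" for c
  proof -
    have "z - of_real c * \<sigma> = u * Complex (x - c * f) y"
      by (simp add: z w u(2) complex_eq_iff algebra_simps)
    then have "(cmod (z - of_real c * \<sigma>))\<^sup>2 = (x - c * f)\<^sup>2 + y\<^sup>2"
      by (simp add: norm_mult u(1) cmod_power2)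
    then show ?thesis by (simp add: \<phi>_def b_def power_divide)
  qed
  define c0 where "c0 = f * S / a"
  have "S\<^sup>2 \<le> 1" using ST(1) zero_le_power2[of T] by linarith
  then have "\<bar>S\<bar> \<le> 1" by (simp add: abs_square_le_1)
  have "f \<le> a" using ab by (auto intro: power2_le_imp_le[of f a])
  have c0: "\<bar>c0\<bar> \<le> 1"
  proof (cases "a = 0")
    case False
    have "f * \<bar>S\<bar> \<le> a * 1" using \<open>f \<le> a\<close> \<open>\<bar>S\<bar> \<le> 1\<close> ab by (intro mult_mono) auto
    then show ?thesis using False ab by (simp add: c0_def abs_mult)
  qed (simp add: c0_def)
  have "\<phi> c0 \<le> 0"
  proof (cases "a = 0")
    case True
    then have "b = 0" using ab by (simp add: add_nonneg_eq_0_iff)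
    moreover have "f = 0" using ab \<open>f \<le> a\<close> True by simp
    ultimately show ?thesis using ST True by (simp add: \<phi>_def)
  next
    case False
    have af: "a * c0 = f * S" using False by (simp add: c0_def)
    have "\<phi> c0 = x\<^sup>2 + y\<^sup>2 - b\<^sup>2 - 2 * x * f * c0 + (b\<^sup>2 + f\<^sup>2) * c0\<^sup>2"
      by (simp add: \<phi>_def power2_eq_square algebra_simps)
    also have "(b\<^sup>2 + f\<^sup>2) * c0\<^sup>2 = (a * c0)\<^sup>2" using ab(4) by (simp add: power_mult_distrib)
    also have "2 * x * f * c0 = 2 * f * S * (a * c0)" by (simp add: ST)
    also have "x\<^sup>2 = (b\<^sup>2 + f\<^sup>2) * S\<^sup>2" unfolding ST(2) using ab(4) by (simp add: power_mult_distrib)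
    finally have "\<phi> c0 = b\<^sup>2 * (S\<^sup>2 + T\<^sup>2 - 1)"
      unfolding af ST(3) by (simp add: power2_eq_square algebra_simps)
    also have "\<dots> \<le> 0" using ST(1) by (simp add: mult_nonneg_nonpos)
    finally show ?thesis .
  qed
  moreover have "0 \<le> \<phi> 1" by (simp add: \<phi>_def)
  moreover have "continuous_on {c0..1} \<phi>" unfolding \<phi>_def by (intro continuous_intros)
  ultimately obtain c where "c0 \<le> c" "c \<le> 1" "\<phi> c = 0"
    using IVT'[of \<phi> c0 0 1] abs_le_D1[OF c0] by blast
  then show ?thesis using that[of c] \<phi>[of c] c0 by auto
qed

section \<open>The numerical range of a triangular two-by-two block\<close>

text \<open>A unit vector \<open>\<alpha> e\<^sub>1 + \<delta> e\<^sub>2\<close> with \<open>|\<alpha>|\<^sup>2 - |\<delta>|\<^sup>2 = c\<close> has the value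
  \<open>c \<sigma> + \<kappa> \<delta> cnj \<alpha>\<close>, and the phase of the second term is arbitrary. So the value runs over the
  circles of \<open>ellipse_chord_parameter\<close> with \<open>k = |\<kappa>|\<close>.\<close>

lemma triangular_block_numerical_range:
  fixes B :: "'a::complex_inner \<Rightarrow> 'a"
  assumes B: "bounded_clinear B"
    and e: "norm e\<^sub>1 = 1" "norm e\<^sub>2 = 1" "cinner e\<^sub>2 e\<^sub>1 = 0"
    and Be: "B e\<^sub>1 = \<sigma> *\<^sub>C e\<^sub>1" "B e\<^sub>2 = \<kappa> *\<^sub>C e\<^sub>1 - \<sigma> *\<^sub>C e\<^sub>2"
    and le: "cmod (z - \<sigma>) + cmod (z + \<sigma>) \<le> sqrt ((cmod \<kappa>)\<^sup>2 + 4 * (cmod \<sigma>)\<^sup>2)"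
  obtains \<alpha> \<delta> where "cmod \<alpha> \<le> 1" "cmod \<delta> \<le> 1" "norm (\<alpha> *\<^sub>C e\<^sub>1 + \<delta> *\<^sub>C e\<^sub>2) = 1"
    "cinner (B (\<alpha> *\<^sub>C e\<^sub>1 + \<delta> *\<^sub>C e\<^sub>2)) (\<alpha> *\<^sub>C e\<^sub>1 + \<delta> *\<^sub>C e\<^sub>2) = z"
proof -
  obtain c where c: "-1 \<le> c" "c \<le> 1"
    "(cmod (z - of_real c * \<sigma>))\<^sup>2 = (cmod \<kappa>)\<^sup>2 / 4 * (1 - c\<^sup>2)"
    using ellipse_chord_parameter[OF norm_ge_zero le] by blast
  define w where "w = z - of_real c * \<sigma>"
  define p q where "p = sqrt ((1 + c) / 2)" and "q = sqrt ((1 - c) / 2)"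
  have pq: "0 \<le> p" "0 \<le> q" "p\<^sup>2 = (1 + c) / 2" "q\<^sup>2 = (1 - c) / 2"
    using c by (auto simp: p_def q_def)
  have pq1: "p\<^sup>2 + q\<^sup>2 = 1" "p\<^sup>2 - q\<^sup>2 = c" using pq by (simp_all add: field_simps)
  have "(cmod \<kappa> * (p * q))\<^sup>2 = (cmod w)\<^sup>2"
    unfolding w_def c(3) power_mult_distrib pq by (simp add: power2_eq_square algebra_simps)
  then have w: "cmod w = cmod \<kappa> * (p * q)"
    using pq(1,2) by (metis mult_nonneg_nonneg norm_ge_zero power2_eq_imp_eq)
  obtain v where v: "cmod v = 1" "w = of_real (cmod w) * v" using complex_polar_unit by blast
  obtain t where t: "cmod t = 1" "\<kappa> = of_real (cmod \<kappa>) * t" using complex_polar_unit by blast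
  have tt: "t * cnj t = 1" using t(1) by (simp add: complex_norm_square[symmetric])
  define \<theta> where "\<theta> = v * cnj t"
  have \<theta>: "cmod \<theta> = 1" by (simp add: \<theta>_def norm_mult v t)
  then have \<theta>1: "\<theta> * cnj \<theta> = 1" by (simp add: complex_norm_square[symmetric])
  have \<kappa>\<theta>: "\<kappa> * of_real (p * q) * \<theta> = w"
  proof -
    have "\<kappa> * of_real (p * q) * \<theta> = of_real (cmod \<kappa>) * of_real (p * q) * v * (t * cnj t)"
      by (subst t(2)) (simp add: \<theta>_def)
    also have "\<dots> = of_real (cmod w) * v" by (simp add: tt w)
    finally show ?thesis using v(2) by simp
  qed
  define \<alpha> \<delta> where "\<alpha> = complex_of_real p" and "\<delta> = complex_of_real q * \<theta>"
  have \<alpha>\<delta>: "\<alpha> * cnj \<alpha> = of_real (p\<^sup>2)" "\<delta> * cnj \<delta> = of_real (q\<^sup>2)"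
  proof -
    show "\<alpha> * cnj \<alpha> = of_real (p\<^sup>2)" by (simp add: \<alpha>_def power2_eq_square)
    have "\<delta> * cnj \<delta> = of_real (q\<^sup>2) * (\<theta> * cnj \<theta>)" by (simp add: \<delta>_def power2_eq_square)
    then show "\<delta> * cnj \<delta> = of_real (q\<^sup>2)" by (simp add: \<theta>1)
  qed
  have e12: "cinner e\<^sub>1 e\<^sub>2 = 0" using e(3) by (subst cinner_commute) simp
  have ee: "cinner e\<^sub>1 e\<^sub>1 = 1" "cinner e\<^sub>2 e\<^sub>2 = 1" using e by (simp_all add: cinner_self)
  define x where "x = \<alpha> *\<^sub>C e\<^sub>1 + \<delta> *\<^sub>C e\<^sub>2"
  have "cinner x x = \<alpha> * cnj \<alpha> + \<delta> * cnj \<delta>"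
    by (simp add: x_def cinner_simps e e12 ee mult.commute)
  also have "\<dots> = of_real (p\<^sup>2 + q\<^sup>2)" by (simp add: \<alpha>\<delta>)
  finally have "(norm x)\<^sup>2 = 1"
    by (simp only: cinner_self pq1 of_real_eq_iff)
  then have nx: "norm x = 1" by (simp add: power2_eq_1_iff) (smt (verit) norm_ge_zero)
  have "B x = (\<alpha> * \<sigma> + \<delta> * \<kappa>) *\<^sub>C e\<^sub>1 - (\<delta> * \<sigma>) *\<^sub>C e\<^sub>2"
    by (simp add: x_def bounded_clinear_add[OF B] bounded_clinear_scaleC[OF B] Be
        scaleC_scaleC scaleC_add_left complex_vector.scale_right_diff_distrib)
  then have "cinner (B x) x = \<sigma> * (\<alpha> * cnj \<alpha>) + \<kappa> * (\<delta> * cnj \<alpha>) - \<sigma> * (\<delta> * cnj \<delta>)"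
    by (simp add: x_def cinner_simps e e12 ee) (simp add: algebra_simps)
  also have "\<dots> = \<sigma> * of_real (p\<^sup>2 - q\<^sup>2) + \<kappa> * of_real (p * q) * \<theta>"
    unfolding \<alpha>\<delta> by (simp add: \<alpha>_def \<delta>_def algebra_simps)
  also have "\<dots> = z" unfolding \<kappa>\<theta> pq1 by (simp add: w_def)
  finally have Bx: "cinner (B x) x = z" .
  have "p \<le> 1" "q \<le> 1" using c by (auto simp: p_def q_def)
  then have "cmod \<alpha> \<le> 1" "cmod \<delta> \<le> 1" using pq \<theta> by (auto simp: \<alpha>_def \<delta>_def norm_mult)
  with nx Bx that show ?thesis by (simp add: x_def)
qed

section \<open>Essential norm and essential numerical range\<close>

lemma essential_norm_le:
  assumes "compact_operator K" "bounded_clinear B" "0 \<le> c" "\<And>x. norm (B x + K x) \<le> c * norm x"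
  shows "essential_norm B \<le> c"
proof -
  have "essential_norm B \<le> onorm (\<lambda>x. B x + K x)"
    unfolding essential_norm_def
  proof (rule cInf_lower)
    have "0 \<le> onorm (\<lambda>x. B x + L x)" if "compact_operator L" for L
      by (intro onorm_pos_le bounded_clinear_bounded_linear bounded_clinear_plus assms(2)
          compact_operator_bounded_clinear[OF that])
    then show "bdd_below {onorm (\<lambda>x. B x + K x) |K. compact_operator K}"
      by (intro bdd_belowI[of _ 0]) auto
  qed (use assms(1) in blast)
  also have "\<dots> \<le> c" using assms(3,4) by (intro onorm_bound) auto
  finally show ?thesis .
qed

lemma essential_norm_lessD:
  assumes "bounded_clinear B" "essential_norm B < s"
  obtains K where "compact_operator K" "\<And>x. norm (B x + K x) \<le> s * norm x"
proof -
  have "{onorm (\<lambda>x. B x + K x) |K. compact_operator K} \<noteq> {}"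
    using compact_operator_zero by blast
  from cInf_lessD[OF this assms(2)[unfolded essential_norm_def]]
  obtain K where K: "compact_operator K" "onorm (\<lambda>x. B x + K x) < s" by blast
  have bl: "bounded_linear (\<lambda>x. B x + K x)"
    by (intro bounded_clinear_bounded_linear bounded_clinear_plus assms(1)
        compact_operator_bounded_clinear[OF K(1)])
  have "norm (B x + K x) \<le> s * norm x" for x
    using onorm[OF bl, of x] mult_right_mono[of "onorm (\<lambda>x. B x + K x)" s "norm x"] K(2) by simp
  with K(1) that show ?thesis by blast
qed

text \<open>If \<open>B\<close> were bounded by \<open>s\<close> on the complement of \<open>F\<close>, then \<open>B (1 - P)\<close>, with \<open>P\<close> the projection
  onto the span of \<open>F\<close>, would be a compact perturbation of \<open>B\<close> of norm at most \<open>s\<close>.\<close>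

lemma essential_norm_attained_on_perp:
  fixes B :: "'a::complex_inner \<Rightarrow> 'b::complex_inner"
  assumes B: "bounded_clinear B" and s: "0 \<le> s" "s < essential_norm B" and F: "orthonormal F"
  obtains u where "u \<in> perp F" "norm u = 1" "s < norm (B u)"
proof (rule ccontr)
  assume "\<not> thesis"
  then have small: "norm (B u) \<le> s" if "u \<in> perp F" "norm u = 1" for u
    using that \<open>\<And>u. u \<in> perp F \<Longrightarrow> norm u = 1 \<Longrightarrow> s < norm (B u) \<Longrightarrow> thesis\<close>
    by (meson not_le)
  have small': "norm (B y) \<le> s * norm y" if y: "y \<in> perp F" for y
  proof (cases "y = 0")
    case True
    then show ?thesis using B by (simp add: bounded_clinear_def linear_simps)
  next
    case False
    have "complex_of_real (1 / norm y) *\<^sub>C y \<in> perp F"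
      using y by (simp add: perp_def cinner_simps)
    then have "norm (B (complex_of_real (1 / norm y) *\<^sub>C y)) \<le> s"
      using False by (intro small) (auto simp: norm_scaleC norm_divide)
    then show ?thesis
      using False by (simp add: bounded_clinear_scaleC[OF B] norm_scaleC norm_divide field_simps)
  qed
  have "compact_operator (\<lambda>x. B (proj F ((-1) *\<^sub>C x)))"
    by (intro compact_operator_compose_left[OF B]
        compact_operator_compose_right[OF compact_operator_proj bounded_clinear_scaleC_const])
  then have "essential_norm B \<le> s"
  proof (rule essential_norm_le[OF _ B s(1)])
    fix x
    have "B x + B (proj F ((-1) *\<^sub>C x)) = B (x - proj F x)"
      unfolding bounded_clinear_add[OF B, symmetric]
      by (simp add: proj_def cinner_simps sum_negf)
    then have "norm (B x + B (proj F ((-1) *\<^sub>C x))) \<le> s * norm (x - proj F x)"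
      using small'[OF diff_proj_perp[OF F, of x]] by simp
    also have "\<dots> \<le> s * norm x"
      using s(1) norm_diff_proj_le[OF F] by (intro mult_left_mono)
    finally show "norm (B x + B (proj F ((-1) *\<^sub>C x))) \<le> s * norm x" .
  qed
  with s(2) show False by simp
qed

text \<open>The operator \<open>(1 - P) B (1 - P)\<close> differs from \<open>B\<close> by a finite rank operator, and its value at
  a unit vector \<open>x\<close> is \<open>\<langle>B y, y\<rangle>\<close> for the component \<open>y\<close> of \<open>x\<close> orthogonal to \<open>F\<close>. This
  component may be short, so the hypothesis concerns the whole unit ball of the complement.\<close>

lemma essential_numerical_range_subset_perp:
  fixes B :: "'a::complex_inner \<Rightarrow> 'a"
  assumes B: "bounded_clinear B" and F: "orthonormal F"
    and "closed E" and E: "\<And>y. y \<in> perp F \<Longrightarrow> norm y \<le> 1 \<Longrightarrow> cinner (B y) y \<in> E"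
  shows "essential_numerical_range B \<subseteq> E"
proof -
  \<comment> \<open>Expanded, \<open>L = (1 - P) B (1 - P) - B = - B P - P B (1 - P)\<close>; each term has the projection as
    a factor and is therefore compact.\<close>
  define L where "L x = B (proj F ((-1) *\<^sub>C x)) + proj F ((-1) *\<^sub>C B (x - proj F x))" for x
  have pneg: "proj F ((-1) *\<^sub>C x) = - proj F x" for x
    by (simp add: proj_def cinner_simps sum_negf)
  have Q: "bounded_clinear (\<lambda>x. x - proj F x)"
  proof -
    have "bounded_clinear (\<lambda>x. 1 *\<^sub>C x + proj F ((-1) *\<^sub>C x))"
      by (intro bounded_clinear_plus bounded_clinear_scaleC_const compact_operator_bounded_clinear
          compact_operator_compose_right[OF compact_operator_proj])
    then show ?thesis unfolding pneg by (simp add: scaleC_one)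
  qed
  have "compact_operator L"
    unfolding L_def[abs_def]
  proof (rule compact_operator_add)
    show "compact_operator (\<lambda>x. B (proj F ((-1) *\<^sub>C x)))"
      by (intro compact_operator_compose_left[OF B]
          compact_operator_compose_right[OF compact_operator_proj bounded_clinear_scaleC_const])
    show "compact_operator (\<lambda>x. proj F ((-1) *\<^sub>C B (x - proj F x)))"
      by (rule compact_operator_compose_right[OF compact_operator_proj
            bounded_clinear_compose[OF bounded_clinear_scaleC_const bounded_clinear_compose[OF B Q]]])
  qed
  moreover have "numerical_range (\<lambda>x. B x + L x) \<subseteq> E"
  proof
    fix z assume "z \<in> numerical_range (\<lambda>x. B x + L x)"
    then obtain x where x: "norm x = 1" "z = cinner (B x + L x) x"
      by (auto simp: numerical_range_def)
    define y where "y = x - proj F x"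
    have y: "y \<in> perp F" "norm y \<le> 1"
      using diff_proj_perp[OF F, of x] norm_diff_proj_le[OF F, of x] x(1) by (auto simp: y_def)
    have BL: "B x + L x = B y - proj F (B y)"
      using bounded_clinear_add[OF B, of x "- proj F x"] by (simp add: L_def pneg y_def del: complex_vector.scale_minus_left)
    have "cinner (B y - proj F (B y)) (proj F x) = 0"
      by (intro cinner_perp_proj diff_proj_perp F)
    moreover have "cinner (proj F (B y)) y = 0"
      by (subst cinner_commute) (simp add: cinner_perp_proj y(1))
    moreover have "x = y + proj F x" by (simp add: y_def)
    ultimately have "z = cinner (B y) y"
      unfolding x(2) BL by (metis add.right_neutral cinner_add_right cinner_diff_left diff_zero)
    then show "z \<in> E" using E[OF y] by simp
  qed
  then have "closure (numerical_range (\<lambda>x. B x + L x)) \<subseteq> E"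
    using \<open>closed E\<close> by (rule closure_minimal)
  ultimately show ?thesis unfolding essential_numerical_range_def by blast
qed

section \<open>The ellipse contains the essential numerical range\<close>

text \<open>Write \<open>z = \<langle>B x, x\<rangle>\<close>, \<open>\<beta> = \<sigma>\<^sup>2\<close> and \<open>p = \<parallel>B x\<parallel>\<^sup>2\<close>, and test the bound on \<open>v = a x + B x\<close>
  with \<open>|a| = s\<close>. Then \<open>\<parallel>B v\<parallel>\<^sup>2 = s\<^sup>2 p + 2 Re (a cnj \<beta> z) + |\<beta>|\<^sup>2\<close> and
  \<open>s\<^sup>2 \<parallel>v\<parallel>\<^sup>2 = s\<^sup>4 + 2 s\<^sup>2 Re (a cnj z) + s\<^sup>2 p\<close>: the choice \<open>|a| = s\<close> is the one for which \<open>p\<close>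
  cancels. The phase of \<open>a\<close> turns the remaining real part into an absolute value.\<close>

lemma square_root_operator_estimate:
  fixes B :: "'a::complex_inner \<Rightarrow> 'a"
  assumes B: "bounded_clinear B" and BB: "\<And>x. B (B x) = \<sigma>\<^sup>2 *\<^sub>C x"
    and x: "norm x = 1" and "0 \<le> s"
    and bound: "\<And>a. cmod a = s \<Longrightarrow>
      (norm (B (a *\<^sub>C x + B x)))\<^sup>2 \<le> s\<^sup>2 * (norm (a *\<^sub>C x + B x))\<^sup>2 + \<eta>"
  shows "2 * s * cmod (of_real (s\<^sup>2) * cnj (cinner (B x) x) - (cnj \<sigma>)\<^sup>2 * cinner (B x) x)
    \<le> s ^ 4 - cmod \<sigma> ^ 4 + \<eta>"
proof -
  define z where "z = cinner (B x) x"
  define w where "w = (cnj \<sigma>)\<^sup>2 * z - of_real (s\<^sup>2) * cnj z"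
  obtain v where v: "cmod v = 1" "w = of_real (cmod w) * v" using complex_polar_unit by blast
  have vv: "cnj v * v = 1" using v(1) by (simp add: complex_norm_square[symmetric] mult.commute)
  define a where "a = of_real s * cnj v"
  have a: "cmod a = s" using v(1) \<open>0 \<le> s\<close> by (simp add: a_def norm_mult)
  have "a * w = of_real s * of_real (cmod w) * (cnj v * v)"
    by (subst v(2)) (simp add: a_def)
  then have aw: "Re (a * w) = s * cmod w" by (simp add: vv)
  have xBx: "cinner x (B x) = cnj z" unfolding z_def by (rule cinner_commute)
  have "B (a *\<^sub>C x + B x) = a *\<^sub>C B x + \<sigma>\<^sup>2 *\<^sub>C x"
    by (simp add: bounded_clinear_add[OF B] bounded_clinear_scaleC[OF B] BB)
  then have "(norm (B (a *\<^sub>C x + B x)))\<^sup>2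
      = s\<^sup>2 * (norm (B x))\<^sup>2 + 2 * Re (a * ((cnj \<sigma>)\<^sup>2 * z)) + cmod \<sigma> ^ 4"
    by (simp add: norm_add_square norm_scaleC a x cinner_simps z_def power_mult_distrib norm_power
        mult.left_commute)
  moreover have "(norm (a *\<^sub>C x + B x))\<^sup>2 = s\<^sup>2 + 2 * Re (a * cnj z) + (norm (B x))\<^sup>2"
    by (simp add: norm_add_square norm_scaleC a x cinner_simps xBx)
  moreover have "Re (a * ((cnj \<sigma>)\<^sup>2 * z)) - s\<^sup>2 * Re (a * cnj z) = Re (a * w)"
    by (simp add: w_def algebra_simps)
  ultimately have "2 * (s * cmod w) \<le> s ^ 4 - cmod \<sigma> ^ 4 + \<eta>"
    using bound[OF a] aw by (simp add: algebra_simps power4_eq_xxxx power2_eq_square)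
  moreover have "cmod w = cmod (of_real (s\<^sup>2) * cnj z - (cnj \<sigma>)\<^sup>2 * z)"
    unfolding w_def by (rule norm_minus_commute)
  ultimately show ?thesis by (simp add: z_def)
qed

text \<open>On unit vectors orthogonal to a suitable finite set, \<open>K\<close> and \<open>K B\<close> are so small that
  \<open>square_root_operator_estimate\<close> holds with an error \<open>\<eta>\<close>, which the factor \<open>\<rho>\<close> absorbs. Shorter
  vectors are covered since the ellipse is star-shaped about its centre.\<close>

lemma essential_numerical_range_focal_sum_le:
  fixes B :: "'a::complex_inner \<Rightarrow> 'a"
  assumes B: "bounded_clinear B" and BB: "\<And>x. B (B x) = \<sigma>\<^sup>2 *\<^sub>C x"
    and s: "cmod \<sigma> < s" "essential_norm B < s" and "1 < \<rho>"
    and z: "z \<in> essential_numerical_range B"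
  shows "cmod (z - \<sigma>) + cmod (z + \<sigma>) \<le> \<rho> * (s + (cmod \<sigma>)\<^sup>2 / s)"
proof -
  define f where "f = cmod \<sigma>"
  have f: "0 \<le> f" "f < s" "0 < s" using s norm_ge_zero[of \<sigma>] by (auto simp: f_def simp del: norm_ge_zero)
  have s4: "0 < s ^ 4 - f ^ 4" using power_strict_mono[of f s 4] f by simp
  obtain K where K: "compact_operator K" "\<And>x. norm (B x + K x) \<le> s * norm x"
    using essential_norm_lessD[OF B s(2)] by blast
  have bK: "bounded_clinear K" using K(1) by (rule compact_operator_bounded_clinear)
  obtain N where N: "N > 0" "\<And>x. norm (B x) \<le> N * norm x"
    using bounded_clinear_bound[OF B] by blast
  \<comment> \<open>The error is at most \<open>\<epsilon> C\<close> for \<open>\<epsilon> \<le> 1\<close>, since \<open>\<parallel>v\<parallel> \<le> s + N\<close> and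
    \<open>\<parallel>K v\<parallel> \<le> \<epsilon> (s + 1)\<close> for \<open>v = a x + B x\<close>.\<close>
  define C where "C = 2 * s * (s + N) * (s + 1) + (s + 1)\<^sup>2"
  define \<eta> where "\<eta> = (\<rho> - 1) * (s ^ 4 - f ^ 4)"
  have "C > 0" using f N by (auto simp: C_def intro!: add_pos_pos)
  have "\<eta> > 0" using s4 assms(5) by (simp add: \<eta>_def)
  define \<epsilon> where "\<epsilon> = min 1 (\<eta> / C)"
  have \<epsilon>: "0 < \<epsilon>" "\<epsilon> \<le> 1" "\<epsilon> * C \<le> \<eta>"
    using \<open>C > 0\<close> \<open>\<eta> > 0\<close> by (auto simp: \<epsilon>_def min_def field_simps)
  obtain F1 where F1: "orthonormal F1" "\<And>x. x \<in> perp F1 \<Longrightarrow> norm (K x) \<le> \<epsilon> * norm x"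
    using compact_operator_small_on_perp[OF K(1), of "{}" \<epsilon>] \<epsilon> by (auto simp: orthonormal_def)
  obtain F where F: "orthonormal F" "F1 \<subseteq> F"
    "\<And>x. x \<in> perp F \<Longrightarrow> norm (K (B x)) \<le> \<epsilon> * norm x"
    using compact_operator_small_on_perp[OF compact_operator_compose_right[OF K(1) B] F1(1) \<epsilon>(1)]
    by blast
  define E where "E = {z. cmod (z - \<sigma>) + cmod (z + \<sigma>) \<le> \<rho> * (s + f\<^sup>2 / s)}"
  have unit: "cinner (B x) x \<in> E" if x: "x \<in> perp F" "norm x = 1" for x
  proof -
    have "(norm (B (a *\<^sub>C x + B x)))\<^sup>2 \<le> s\<^sup>2 * (norm (a *\<^sub>C x + B x))\<^sup>2 + \<eta>"
      if a: "cmod a = s" for a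
    proof -
      define v where "v = a *\<^sub>C x + B x"
      have "norm v \<le> s + N"
        using norm_triangle_ineq[of "a *\<^sub>C x" "B x"] N(2)[of x] x(2) a
        by (simp add: v_def norm_scaleC)
      have "norm (K x) \<le> \<epsilon>" "norm (K (B x)) \<le> \<epsilon>"
        using F1(2)[of x] F(3)[of x] x perp_antimono[OF F(2)] by auto
      then have "norm (K v) \<le> s * \<epsilon> + \<epsilon>"
        using norm_triangle_ineq[of "a *\<^sub>C K x" "K (B x)"] mult_left_mono[of "norm (K x)" \<epsilon> s] f
        unfolding v_def bounded_clinear_add[OF bK] bounded_clinear_scaleC[OF bK] norm_scaleC a
        by linarith
      then have Kv: "norm (K v) \<le> \<epsilon> * (s + 1)" by (simp add: algebra_simps)
      have "norm (B v) \<le> norm (B v + K v) + norm (K v)"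
        using norm_triangle_ineq4[of "B v + K v" "K v"] by simp
      also have "\<dots> \<le> s * norm v + \<epsilon> * (s + 1)" using K(2)[of v] Kv by simp
      finally have "(norm (B v))\<^sup>2 \<le> (s * norm v + \<epsilon> * (s + 1))\<^sup>2" by (intro power_mono) auto
      also have "\<dots> = s\<^sup>2 * (norm v)\<^sup>2 + \<epsilon> * (2 * s * (s + 1) * norm v) + \<epsilon> * (\<epsilon> * (s + 1)\<^sup>2)"
        by (simp add: power2_eq_square algebra_simps)
      also have "\<dots> \<le> s\<^sup>2 * (norm v)\<^sup>2 + \<epsilon> * (2 * s * (s + 1) * (s + N)) + \<epsilon> * (1 * (s + 1)\<^sup>2)"
        using \<epsilon> f \<open>norm v \<le> s + N\<close> by (intro add_mono mult_left_mono mult_right_mono) auto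
      also have "\<dots> = s\<^sup>2 * (norm v)\<^sup>2 + \<epsilon> * C" by (simp add: C_def algebra_simps)
      finally show ?thesis using \<epsilon>(3) by (simp add: v_def)
    qed
    from square_root_operator_estimate[OF B BB x(2) less_imp_le[OF f(3)] this]
    have "2 * s * cmod (of_real (s\<^sup>2) * cnj (cinner (B x) x) - (cnj \<sigma>)\<^sup>2 * cinner (B x) x)
        \<le> s ^ 4 - cmod \<sigma> ^ 4 + \<eta>" .
    also have "\<dots> = \<rho> * (s ^ 4 - cmod \<sigma> ^ 4)" by (simp add: \<eta>_def f_def algebra_simps)
    finally show ?thesis
      using focal_sum_le_of_relaxed_conj_bound[OF s(1), of \<rho>] assms(5) by (simp add: E_def f_def)
  qed
  have "2 * f \<le> s + f\<^sup>2 / s" using focal_distance_le_major_axis[OF f(3)] .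
  also have "\<dots> \<le> \<rho> * (s + f\<^sup>2 / s)"
    using assms(5) f mult_right_mono[of 1 \<rho> "s + f\<^sup>2 / s"] by simp
  finally have f_le: "2 * f \<le> \<rho> * (s + f\<^sup>2 / s)" .
  have ball: "cinner (B y) y \<in> E" if y: "y \<in> perp F" "norm y \<le> 1" for y
  proof (cases "y = 0")
    case True
    then show ?thesis using f_le by (simp add: E_def f_def)
  next
    case False
    define x where "x = complex_of_real (1 / norm y) *\<^sub>C y"
    have "x \<in> perp F" using y by (simp add: x_def perp_def cinner_simps)
    moreover have "norm x = 1" using False by (simp add: x_def norm_scaleC norm_divide)
    ultimately have xE: "cinner (B x) x \<in> E" by (rule unit)
    define r where "r = (norm y)\<^sup>2"
    have r: "0 \<le> r" "r \<le> 1" using y(2) by (auto simp: r_def power_le_one)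
    have "cinner (B y) y = of_real r * cinner (B x) x"
      using False
      by (simp add: x_def r_def bounded_clinear_scaleC[OF B] cinner_simps power2_eq_square)
    then have "cmod (cinner (B y) y - \<sigma>) + cmod (cinner (B y) y + \<sigma>)
        \<le> r * (cmod (cinner (B x) x - \<sigma>) + cmod (cinner (B x) x + \<sigma>)) + (1 - r) * (2 * f)"
      using focal_sum_scale[OF r, of "cinner (B x) x" \<sigma>] by (simp add: f_def)
    also have "\<dots> \<le> r * (\<rho> * (s + f\<^sup>2 / s)) + (1 - r) * (\<rho> * (s + f\<^sup>2 / s))"
      using xE f_le r by (intro add_mono mult_left_mono) (auto simp: E_def)
    also have "\<dots> = \<rho> * (s + f\<^sup>2 / s)" by (simp only: distrib_right[symmetric]) simp
    finally show ?thesis by (simp add: E_def)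
  qed
  have "closed E" unfolding E_def by (intro closed_Collect_le continuous_intros)
  from essential_numerical_range_subset_perp[OF B F(1) this ball] z
  show ?thesis by (auto simp: E_def f_def)
qed

text \<open>A compact perturbation \<open>L\<close> changes the value at a unit vector \<open>x\<close> by at most \<open>\<parallel>L x\<parallel>\<close>.\<close>

lemma in_essential_numerical_rangeI:
  fixes B :: "'a::complex_inner \<Rightarrow> 'a"
  assumes "\<And>(L :: 'a \<Rightarrow> 'a) \<epsilon>. compact_operator L \<Longrightarrow> 0 < \<epsilon> \<Longrightarrow>
    \<exists>x. norm x = 1 \<and> cinner (B x) x = z \<and> norm (L x) < \<epsilon>"
  shows "z \<in> essential_numerical_range B"
  unfolding essential_numerical_range_def
proof (rule INT_I, clarify)
  fix L :: "'a \<Rightarrow> 'a" assume L: "compact_operator L"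
  show "z \<in> closure (numerical_range (\<lambda>x. B x + L x))"
    unfolding closure_approachable
  proof (intro allI impI)
    fix \<epsilon> :: real assume "0 < \<epsilon>"
    from assms[OF L this] obtain x where
      x: "norm x = 1" "cinner (B x) x = z" "norm (L x) < \<epsilon>" by blast
    have "dist (cinner (B x + L x) x) z = cmod (cinner (L x) x)"
      by (simp add: dist_norm cinner_simps x(2))
    also have "\<dots> < \<epsilon>" using cinner_Cauchy_Schwarz[of "L x" x] x by simp
    finally show "\<exists>y\<in>numerical_range (\<lambda>x. B x + L x). dist y z < \<epsilon>"
      using x(1) by (auto simp: numerical_range_def)
  qed
qed

lemma closed_essential_numerical_range: "closed (essential_numerical_range B)"
  unfolding essential_numerical_range_def by (intro closed_INT) auto

section \<open>The essential numerical range contains the ellipse\<close>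

text \<open>The triangular matrix with diagonal \<open>f, - f\<close> and corner \<open>m = s - f\<^sup>2 / s\<close> has norm \<open>s\<close>: for
  nonnegative \<open>c\<close>, \<open>d\<close> on the unit circle the defect of \<open>s\<^sup>2\<close> is the multiple
  \<open>(m / s) (c s - d f)\<^sup>2\<close> of a square. A smaller corner cannot stretch a unit vector beyond \<open>s\<close>.\<close>

lemma corner_entry_lower_bound:
  fixes f k s c d :: real
  assumes "0 \<le> f" "f < s" "0 \<le> k" "0 \<le> c" "0 \<le> d" "c\<^sup>2 + d\<^sup>2 = 1"
    and big: "s\<^sup>2 < (c * f + d * k)\<^sup>2 + (d * f)\<^sup>2"
  shows "s - f\<^sup>2 / s \<le> k"
proof (rule ccontr)
  define m where "m = s - f\<^sup>2 / s"
  assume "\<not> s - f\<^sup>2 / s \<le> k"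
  then have "k \<le> m" by (simp add: m_def)
  have s: "0 < s" using assms by simp
  have "f\<^sup>2 \<le> s\<^sup>2" using assms by (intro power_mono) auto
  then have "0 \<le> m" using s by (simp add: m_def field_simps power2_eq_square)
  have "(c * f + d * k)\<^sup>2 \<le> (c * f + d * m)\<^sup>2"
    using assms \<open>k \<le> m\<close> by (intro power_mono add_left_mono mult_left_mono) auto
  moreover have "(c * f + d * m)\<^sup>2 + (d * f)\<^sup>2 = s\<^sup>2 - m / s * (c * s - d * f)\<^sup>2"
  proof -
    have ms: "m * s = s\<^sup>2 - f\<^sup>2" using s by (simp add: m_def field_simps power2_eq_square)
    have "s * ((c * f + d * m)\<^sup>2 + (d * f)\<^sup>2) = s * s\<^sup>2 - m * (c * s - d * f)\<^sup>2"
    proof -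
      have "s * ((c * f + d * m)\<^sup>2 + (d * f)\<^sup>2) + m * (c * s - d * f)\<^sup>2
        = c\<^sup>2 * (s * f\<^sup>2 + (m * s) * s) + d\<^sup>2 * ((m * s) * m + s * f\<^sup>2 + m * f\<^sup>2)"
        by (simp add: power2_eq_square algebra_simps)
      also have "s * f\<^sup>2 + (m * s) * s = s * s\<^sup>2"
        unfolding ms by (simp add: algebra_simps power2_eq_square)
      also have "(m * s) * m + s * f\<^sup>2 + m * f\<^sup>2 = s * (m * s) + s * f\<^sup>2"
      proof -
        have "(m * s) * m + s * f\<^sup>2 + m * f\<^sup>2 = s\<^sup>2 * m + s * f\<^sup>2"
          unfolding ms by (simp add: algebra_simps)
        then show ?thesis by (simp add: power2_eq_square)
      qed
      also have "\<dots> = s * s\<^sup>2" unfolding ms by (simp add: algebra_simps)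
      also have "c\<^sup>2 * (s * s\<^sup>2) + d\<^sup>2 * (s * s\<^sup>2) = s * s\<^sup>2"
        by (simp only: distrib_right[symmetric] assms(6) mult_1)
      finally show ?thesis by linarith
    qed
    then show ?thesis using s by (simp add: field_simps)
  qed
  moreover have "0 \<le> m / s * (c * s - d * f)\<^sup>2" using \<open>0 \<le> m\<close> s by simp
  ultimately show False using big by linarith
qed

text \<open>As \<open>(B - \<sigma>) (B + \<sigma>) = 0\<close>, the vector \<open>g = B u + \<sigma> u\<close> is an eigenvector for \<open>\<sigma>\<close>; normalise it
  to \<open>e\<^sub>1\<close> and apply Gram-Schmidt to \<open>u\<close> to obtain \<open>e\<^sub>2\<close>. Because \<open>\<parallel>B u\<parallel>\<close> exceeds \<open>s > |\<sigma>|\<close>, neither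
  normalising factor is close to zero, with bounds that depend only on \<open>s\<close>, \<open>\<sigma>\<close> and \<open>N\<close>. So an
  operator that is small at \<open>u\<close> and \<open>B u\<close> is small at \<open>e\<^sub>1\<close> and \<open>e\<^sub>2\<close>, uniformly in \<open>u\<close>.\<close>

lemma triangular_block_of_large_vector:
  fixes B :: "'a::complex_inner \<Rightarrow> 'a"
  assumes B: "bounded_clinear B" and BB: "\<And>x. B (B x) = \<sigma>\<^sup>2 *\<^sub>C x"
    and N: "0 < N" "\<And>x. norm (B x) \<le> N * norm x"
    and s: "cmod \<sigma> < s" and u: "norm u = 1" "s < norm (B u)"
  obtains e\<^sub>1 e\<^sub>2 \<kappa> where "norm e\<^sub>1 = 1" "norm e\<^sub>2 = 1" "cinner e\<^sub>2 e\<^sub>1 = 0"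
    "B e\<^sub>1 = \<sigma> *\<^sub>C e\<^sub>1" "B e\<^sub>2 = \<kappa> *\<^sub>C e\<^sub>1 - \<sigma> *\<^sub>C e\<^sub>2"
    "s - (cmod \<sigma>)\<^sup>2 / s \<le> cmod \<kappa>"
    "\<And>(L :: 'a \<Rightarrow> 'a) \<epsilon>. bounded_clinear L \<Longrightarrow> norm (L u) \<le> \<epsilon> \<Longrightarrow> norm (L (B u)) \<le> \<epsilon> \<Longrightarrow>
      norm (L e\<^sub>1) \<le> \<epsilon> * ((1 + cmod \<sigma>) / (s - cmod \<sigma>)) \<and>
      norm (L e\<^sub>2) \<le> \<epsilon> * ((1 + (1 + cmod \<sigma>) / (s - cmod \<sigma>)) * (N / (s - cmod \<sigma>)))"
proof -
  define f where "f = cmod \<sigma>"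
  define d where "d = s - f"
  have f: "0 \<le> f" "f < s" "0 < d" using s by (auto simp: f_def d_def)
  define g where "g = B u + \<sigma> *\<^sub>C u"
  define n1 where "n1 = norm g"
  have "norm (B u) \<le> norm g + norm (\<sigma> *\<^sub>C u)"
    using norm_triangle_ineq4[of g "\<sigma> *\<^sub>C u"] by (simp add: g_def)
  then have n1: "d \<le> n1" using u by (simp add: n1_def d_def f_def norm_scaleC)
  then have n1_pos: "0 < n1" using f by simp
  define e1 where "e1 = complex_of_real (1 / n1) *\<^sub>C g"
  have ne1: "norm e1 = 1" using n1_pos by (simp add: e1_def norm_scaleC norm_divide) (simp add: n1_def)
  have g: "g = of_real n1 *\<^sub>C e1"
    using n1_pos by (simp add: e1_def scaleC_scaleC scaleC_one)
  have "B g = \<sigma> *\<^sub>C g"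
    by (simp add: g_def bounded_clinear_add[OF B] bounded_clinear_scaleC[OF B] BB
        scaleC_add_right scaleC_scaleC power2_eq_square add.commute)
  then have Be1: "B e1 = \<sigma> *\<^sub>C e1"
    by (simp add: e1_def bounded_clinear_scaleC[OF B] scaleC_scaleC mult.commute)
  define \<alpha> where "\<alpha> = cinner u e1"
  define h where "h = u - \<alpha> *\<^sub>C e1"
  define n2 where "n2 = norm h"
  have he1: "cinner h e1 = 0"
    using ne1 by (simp add: h_def cinner_simps \<alpha>_def cinner_self)
  then have "cinner h (\<alpha> *\<^sub>C e1) = 0" by (simp add: cinner_simps)
  from norm_add_square_orthogonal[OF this]
  have pyth: "n2\<^sup>2 + (cmod \<alpha>)\<^sup>2 = 1" using u ne1 by (simp add: h_def n2_def norm_scaleC)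
  have \<alpha>1: "cmod \<alpha> \<le> 1" using cinner_Cauchy_Schwarz[of u e1] u ne1 by (simp add: \<alpha>_def)
  have "B u = B h + \<alpha> *\<^sub>C \<sigma> *\<^sub>C e1"
    by (simp add: h_def bounded_clinear_diff[OF B] bounded_clinear_scaleC[OF B] Be1)
  then have "norm (B u) \<le> N * n2 + cmod \<alpha> * f"
    using norm_triangle_ineq[of "B h" "\<alpha> *\<^sub>C \<sigma> *\<^sub>C e1"] N(2)[of h] ne1
    by (simp add: norm_scaleC norm_mult n2_def f_def)
  also have "cmod \<alpha> * f \<le> f" using \<alpha>1 f mult_right_mono[of "cmod \<alpha>" 1 f] by simp
  finally have "d \<le> N * n2" using u by (simp add: d_def)
  then have n2: "d / N \<le> n2" using N by (simp add: field_simps)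
  then have n2_pos: "0 < n2" using f N by (smt (verit) divide_pos_pos)
  define e2 where "e2 = complex_of_real (1 / n2) *\<^sub>C h"
  have ne2: "norm e2 = 1" using n2_pos by (simp add: e2_def norm_scaleC norm_divide) (simp add: n2_def)
  have e21: "cinner e2 e1 = 0" by (simp add: e2_def cinner_simps he1)
  have u_eq: "u = \<alpha> *\<^sub>C e1 + of_real n2 *\<^sub>C e2"
    using n2_pos by (simp add: e2_def h_def scaleC_scaleC scaleC_one)
  define \<kappa> where "\<kappa> = (of_real n1 - 2 * \<sigma> * \<alpha>) / of_real n2"
  have "B h = of_real n1 *\<^sub>C e1 - \<sigma> *\<^sub>C u - (\<alpha> * \<sigma>) *\<^sub>C e1"
    using g by (simp add: h_def bounded_clinear_diff[OF B] bounded_clinear_scaleC[OF B] Be1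
        scaleC_scaleC g_def eq_diff_eq)
  also have "\<dots> = (of_real n1 - 2 * \<sigma> * \<alpha>) *\<^sub>C e1 - \<sigma> *\<^sub>C h"
  proof -
    have "(2 * \<sigma> * \<alpha>) *\<^sub>C e1 = (\<alpha> * \<sigma>) *\<^sub>C e1 + (\<alpha> * \<sigma>) *\<^sub>C e1"
      unfolding scaleC_add_left[symmetric] by (simp add: mult_ac)
    then show ?thesis
      by (simp add: h_def scaleC_scaleC complex_vector.scale_right_diff_distrib
          complex_vector.scale_left_diff_distrib mult.commute)
  qed
  finally have Be2: "B e2 = \<kappa> *\<^sub>C e1 - \<sigma> *\<^sub>C e2"
    using n2_pos by (simp add: e2_def \<kappa>_def bounded_clinear_scaleC[OF B] scaleC_scaleC
        complex_vector.scale_right_diff_distrib mult.commute)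
  have Bu: "B u = (\<alpha> * \<sigma> + of_real n2 * \<kappa>) *\<^sub>C e1 + (- (of_real n2 * \<sigma>)) *\<^sub>C e2"
    by (subst u_eq) (simp add: bounded_clinear_add[OF B] bounded_clinear_scaleC[OF B] Be1 Be2
        scaleC_scaleC scaleC_add_left complex_vector.scale_right_diff_distrib)
  have "cinner e1 e2 = 0" using e21 by (subst cinner_commute) simp
  then have "cinner ((\<alpha> * \<sigma> + of_real n2 * \<kappa>) *\<^sub>C e1) ((- (of_real n2 * \<sigma>)) *\<^sub>C e2) = 0"
    by (simp only: cinner_scaleC_left cinner_scaleC_right mult_zero_right)
  from norm_add_square_orthogonal[OF this]
  have "(norm (B u))\<^sup>2 = (cmod (\<alpha> * \<sigma> + of_real n2 * \<kappa>))\<^sup>2 + (n2 * f)\<^sup>2"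
    unfolding Bu norm_scaleC using ne1 ne2 n2_pos by (simp add: norm_mult f_def)
  moreover have "cmod (\<alpha> * \<sigma> + of_real n2 * \<kappa>) \<le> cmod \<alpha> * f + n2 * cmod \<kappa>"
    using norm_triangle_ineq[of "\<alpha> * \<sigma>" "of_real n2 * \<kappa>"] n2_pos by (simp add: norm_mult f_def)
  then have "(cmod (\<alpha> * \<sigma> + of_real n2 * \<kappa>))\<^sup>2 \<le> (cmod \<alpha> * f + n2 * cmod \<kappa>)\<^sup>2"
    by (intro power_mono) auto
  moreover have "s\<^sup>2 < (norm (B u))\<^sup>2" using u f by (intro power_strict_mono) auto
  ultimately have "s\<^sup>2 < (cmod \<alpha> * f + n2 * cmod \<kappa>)\<^sup>2 + (n2 * f)\<^sup>2" by linarith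
  then have \<kappa>: "s - f\<^sup>2 / s \<le> cmod \<kappa>"
    using f n2_pos pyth by (intro corner_entry_lower_bound[of f s "cmod \<kappa>" "cmod \<alpha>" n2]) auto
  have "norm (L e1) \<le> \<epsilon> * ((1 + f) / d) \<and> norm (L e2) \<le> \<epsilon> * ((1 + (1 + f) / d) * (N / d))"
    if L: "bounded_clinear L" and Lu: "norm (L u) \<le> \<epsilon>" "norm (L (B u)) \<le> \<epsilon>"
    for L :: "'a \<Rightarrow> 'a" and \<epsilon>
  proof
    have \<epsilon>: "0 \<le> \<epsilon>" using Lu(1) norm_ge_zero[of "L u"] by linarith
    have "norm (L g) \<le> norm (L (B u)) + f * norm (L u)"
      using norm_triangle_ineq[of "L (B u)" "\<sigma> *\<^sub>C L u"]
      by (simp add: g_def bounded_clinear_add[OF L] bounded_clinear_scaleC[OF L] norm_scaleC f_def)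
    also have "\<dots> \<le> \<epsilon> + f * \<epsilon>" using Lu f by (intro add_mono mult_left_mono) auto
    finally have Lg: "norm (L g) \<le> \<epsilon> * (1 + f)" by (simp add: algebra_simps)
    have "norm (L e1) = norm (L g) / n1"
      using n1_pos by (simp add: e1_def bounded_clinear_scaleC[OF L] norm_scaleC norm_divide)
    also have "\<dots> \<le> \<epsilon> * (1 + f) / d" using Lg n1 f \<epsilon> by (intro frac_le) auto
    finally show Le1: "norm (L e1) \<le> \<epsilon> * ((1 + f) / d)" by simp
    have "norm (L h) \<le> norm (L u) + cmod \<alpha> * norm (L e1)"
      using norm_triangle_ineq4[of "L u" "\<alpha> *\<^sub>C L e1"]
      by (simp add: h_def bounded_clinear_diff[OF L] bounded_clinear_scaleC[OF L] norm_scaleC)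
    also have "\<dots> \<le> \<epsilon> + 1 * (\<epsilon> * ((1 + f) / d))"
      using Lu Le1 \<alpha>1 by (intro add_mono mult_mono) auto
    finally have Lh: "norm (L h) \<le> \<epsilon> * (1 + (1 + f) / d)" by (simp add: algebra_simps)
    have "norm (L e2) = norm (L h) / n2"
      using n2_pos by (simp add: e2_def bounded_clinear_scaleC[OF L] norm_scaleC norm_divide)
    also have "\<dots> \<le> \<epsilon> * (1 + (1 + f) / d) / (d / N)"
      using Lh n2 f \<epsilon> N by (intro frac_le) auto
    finally show "norm (L e2) \<le> \<epsilon> * ((1 + (1 + f) / d) * (N / d))" by simp
  qed
  from that[OF ne1 ne2 e21 Be1 Be2 \<kappa>[unfolded f_def] this[unfolded d_def f_def]]
  show ?thesis by blast
qed

text \<open>For a compact \<open>L\<close>, choose \<open>u\<close> orthogonal to a finite set on whose orthogonal complement \<open>L\<close> and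
  \<open>L B\<close> are small, with \<open>\<parallel>B u\<parallel> > s\<close>.
  The identity \<open>(s + f\<^sup>2 / s)\<^sup>2 = (s - f\<^sup>2 / s)\<^sup>2 + 4 f\<^sup>2\<close> matches the corner bound with the major
  axis of the ellipse.\<close>

lemma essential_numerical_range_contains_ellipse:
  fixes B :: "'a::complex_inner \<Rightarrow> 'a"
  assumes B: "bounded_clinear B" and BB: "\<And>x. B (B x) = \<sigma>\<^sup>2 *\<^sub>C x"
    and s: "cmod \<sigma> < s" "s < essential_norm B"
    and z: "cmod (z - \<sigma>) + cmod (z + \<sigma>) \<le> s + (cmod \<sigma>)\<^sup>2 / s"
  shows "z \<in> essential_numerical_range B"
proof (rule in_essential_numerical_rangeI)
  fix L :: "'a \<Rightarrow> 'a" and \<epsilon> :: real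
  assume L: "compact_operator L" and "0 < \<epsilon>"
  have bL: "bounded_clinear L" using L by (rule compact_operator_bounded_clinear)
  define f where "f = cmod \<sigma>"
  have f: "0 \<le> f" "f < s" "0 < s" using s norm_ge_zero[of \<sigma>] by (auto simp: f_def simp del: norm_ge_zero)
  obtain N where N: "N > 0" "\<And>x. norm (B x) \<le> N * norm x"
    using bounded_clinear_bound[OF B] by blast
  define C1 where "C1 = (1 + f) / (s - f)"
  define C2 where "C2 = (1 + (1 + f) / (s - f)) * (N / (s - f))"
  have C: "0 < C1" "0 < C2"
    using f N by (auto simp: C1_def C2_def intro!: mult_pos_pos divide_pos_pos add_pos_nonneg)
  define \<eta> where "\<eta> = \<epsilon> / (2 * (C1 + C2))"
  have "0 < \<eta>" using \<open>0 < \<epsilon>\<close> C by (simp add: \<eta>_def)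
  obtain F1 where F1: "orthonormal F1" "\<And>x. x \<in> perp F1 \<Longrightarrow> norm (L x) \<le> \<eta> * norm x"
    using compact_operator_small_on_perp[OF L, of "{}" \<eta>] \<open>0 < \<eta>\<close> by (auto simp: orthonormal_def)
  obtain F where F: "orthonormal F" "F1 \<subseteq> F"
    "\<And>x. x \<in> perp F \<Longrightarrow> norm (L (B x)) \<le> \<eta> * norm x"
    using compact_operator_small_on_perp[OF compact_operator_compose_right[OF L B] F1(1) \<open>0 < \<eta>\<close>]
    by blast
  obtain u where u: "u \<in> perp F" "norm u = 1" "s < norm (B u)"
    using essential_norm_attained_on_perp[OF B less_imp_le[OF f(3)] s(2) F(1)] by blast
  have Lu: "norm (L u) \<le> \<eta>" "norm (L (B u)) \<le> \<eta>"
    using F1(2)[of u] F(3)[of u] u perp_antimono[OF F(2)] by auto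
  obtain e\<^sub>1 e\<^sub>2 \<kappa> where e: "norm e\<^sub>1 = 1" "norm e\<^sub>2 = 1" "cinner e\<^sub>2 e\<^sub>1 = 0"
    "B e\<^sub>1 = \<sigma> *\<^sub>C e\<^sub>1" "B e\<^sub>2 = \<kappa> *\<^sub>C e\<^sub>1 - \<sigma> *\<^sub>C e\<^sub>2"
    and \<kappa>: "s - f\<^sup>2 / s \<le> cmod \<kappa>"
    and Le: "norm (L e\<^sub>1) \<le> \<eta> * C1" "norm (L e\<^sub>2) \<le> \<eta> * C2"
    using triangular_block_of_large_vector[OF B BB N s(1) u(2,3)] bL Lu
    unfolding C1_def C2_def f_def by metis
  have "f\<^sup>2 \<le> s\<^sup>2" using f by (intro power_mono) auto
  then have "0 \<le> s - f\<^sup>2 / s" using f by (simp add: field_simps power2_eq_square)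
  then have "(s - f\<^sup>2 / s)\<^sup>2 \<le> (cmod \<kappa>)\<^sup>2" using \<kappa> by (intro power_mono)
  moreover have "(s + f\<^sup>2 / s)\<^sup>2 = (s - f\<^sup>2 / s)\<^sup>2 + 4 * f\<^sup>2"
    using f by (simp add: power2_sum power2_diff)
  ultimately have "s + f\<^sup>2 / s \<le> sqrt ((cmod \<kappa>)\<^sup>2 + 4 * f\<^sup>2)"
    by (intro real_le_rsqrt) simp
  then have "cmod (z - \<sigma>) + cmod (z + \<sigma>) \<le> sqrt ((cmod \<kappa>)\<^sup>2 + 4 * (cmod \<sigma>)\<^sup>2)"
    using z by (simp add: f_def)
  from triangular_block_numerical_range[OF B e this]
  obtain \<alpha> \<delta> where x: "cmod \<alpha> \<le> 1" "cmod \<delta> \<le> 1" "norm (\<alpha> *\<^sub>C e\<^sub>1 + \<delta> *\<^sub>C e\<^sub>2) = 1"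
    "cinner (B (\<alpha> *\<^sub>C e\<^sub>1 + \<delta> *\<^sub>C e\<^sub>2)) (\<alpha> *\<^sub>C e\<^sub>1 + \<delta> *\<^sub>C e\<^sub>2) = z" by blast
  have "norm (L (\<alpha> *\<^sub>C e\<^sub>1 + \<delta> *\<^sub>C e\<^sub>2)) \<le> cmod \<alpha> * norm (L e\<^sub>1) + cmod \<delta> * norm (L e\<^sub>2)"
    using norm_triangle_ineq[of "\<alpha> *\<^sub>C L e\<^sub>1" "\<delta> *\<^sub>C L e\<^sub>2"]
    by (simp add: bounded_clinear_add[OF bL] bounded_clinear_scaleC[OF bL] norm_scaleC)
  also have "\<dots> \<le> 1 * (\<eta> * C1) + 1 * (\<eta> * C2)"
    using x Le by (intro add_mono mult_mono) auto
  also have "\<dots> = \<eta> * (C1 + C2)" by (simp add: distrib_left)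
  also have "\<dots> = \<epsilon> / 2" using add_pos_pos[OF C] by (simp add: \<eta>_def field_simps del: distrib_left_numeral)
  also have "\<dots> < \<epsilon>" using \<open>0 < \<epsilon>\<close> by simp
  finally show "\<exists>x. norm x = 1 \<and> cinner (B x) x = z \<and> norm (L x) < \<epsilon>"
    using x(3,4) by blast
qed

lemma subspace_eigenvectors:
  assumes "bounded_clinear (B :: 'a::complex_inner \<Rightarrow> 'a)"
  shows "complex_vector.subspace {x. B x = l *\<^sub>C x}"
proof -
  have "B 0 = 0" using assms by (simp add: bounded_clinear_def linear_simps)
  then show ?thesis
    by (simp add: complex_vector.subspace_def bounded_clinear_add[OF assms]
        bounded_clinear_scaleC[OF assms] scaleC_add_right scaleC_scaleC mult.commute)
qed

text \<open>Any compact perturbation is almost invisible at some unit eigenvector.\<close>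

lemma eigenvalue_le_essential_norm:
  fixes B :: "'a::complex_inner \<Rightarrow> 'a"
  assumes B: "bounded_clinear B" and inf: "infinite_dimensional {x. B x = l *\<^sub>C x}"
  shows "cmod l \<le> essential_norm B"
proof (rule ccontr)
  assume "\<not> ?thesis"
  then obtain s where s: "essential_norm B < s" "s < cmod l" using dense not_le by blast
  obtain K where K: "compact_operator K" "\<And>x. norm (B x + K x) \<le> s * norm x"
    using essential_norm_lessD[OF B s(1)] by blast
  define \<epsilon> where "\<epsilon> = (cmod l - s) / 2"
  have "0 < \<epsilon>" using s by (simp add: \<epsilon>_def)
  obtain F where F: "orthonormal F" "\<And>x. x \<in> perp F \<Longrightarrow> norm (K x) \<le> \<epsilon> * norm x"
    using compact_operator_small_on_perp[OF K(1), of "{}" \<epsilon>] \<open>0 < \<epsilon>\<close> by (auto simp: orthonormal_def)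
  obtain e where e: "B e = l *\<^sub>C e" "e \<in> perp F" "norm e = 1"
    using infinite_dimensional_unit_perp[OF inf subspace_eigenvectors[OF B], of F] F(1)
    by (auto simp: orthonormal_def)
  have "cmod l \<le> norm (B e + K e) + norm (K e)"
    using norm_triangle_ineq4[of "B e + K e" "K e"] e by (simp add: norm_scaleC)
  also have "\<dots> \<le> s + \<epsilon>" using K(2)[of e] F(2)[OF e(2)] e(3) by simp
  also have "\<dots> < cmod l" using s by (simp add: \<epsilon>_def field_simps)
  finally show False by simp
qed

text \<open>Two orthogonal eigenvectors, one for each eigenvalue, span a block with corner entry \<open>0\<close>. This
  supplies the degenerate case, where a vector \<open>u\<close> with \<open>\<parallel>B u\<parallel>\<close> above \<open>|\<sigma>|\<close> by a fixed margin need
  not exist.\<close>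

lemma essential_numerical_range_contains_segment:
  fixes B :: "'a::complex_inner \<Rightarrow> 'a"
  assumes B: "bounded_clinear B"
    and inf: "infinite_dimensional {x. B x = \<sigma> *\<^sub>C x}" "infinite_dimensional {x. B x = (- \<sigma>) *\<^sub>C x}"
    and z: "cmod (z - \<sigma>) + cmod (z + \<sigma>) \<le> 2 * cmod \<sigma>"
  shows "z \<in> essential_numerical_range B"
proof (rule in_essential_numerical_rangeI)
  fix L :: "'a \<Rightarrow> 'a" and \<epsilon> :: real
  assume L: "compact_operator L" and "0 < \<epsilon>"
  define \<eta> where "\<eta> = \<epsilon> / 2"
  have \<eta>: "0 < \<eta>" "\<eta> < \<epsilon>" using \<open>0 < \<epsilon>\<close> by (simp_all add: \<eta>_def)
  obtain F where F: "orthonormal F" "\<And>x. x \<in> perp F \<Longrightarrow> norm (L x) \<le> \<eta> * norm x"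
    using compact_operator_small_on_perp[OF L, of "{}" \<eta>] \<eta>(1)
    by (auto simp: orthonormal_def)
  have fin: "finite F" using F(1) by (simp add: orthonormal_def)
  obtain e\<^sub>1 where e1: "B e\<^sub>1 = \<sigma> *\<^sub>C e\<^sub>1" "e\<^sub>1 \<in> perp F" "norm e\<^sub>1 = 1"
    using infinite_dimensional_unit_perp[OF inf(1) subspace_eigenvectors[OF B] fin] by auto
  obtain e\<^sub>2 where e2: "B e\<^sub>2 = (- \<sigma>) *\<^sub>C e\<^sub>2" "e\<^sub>2 \<in> perp (insert e\<^sub>1 F)" "norm e\<^sub>2 = 1"
    using infinite_dimensional_unit_perp[OF inf(2) subspace_eigenvectors[OF B], of "insert e\<^sub>1 F"] fin
    by auto
  have "cinner e\<^sub>2 e\<^sub>1 = 0" "B e\<^sub>2 = 0 *\<^sub>C e\<^sub>1 - \<sigma> *\<^sub>C e\<^sub>2"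
    using e2 by (simp_all add: perp_def)
  moreover have "cmod (z - \<sigma>) + cmod (z + \<sigma>) \<le> sqrt ((cmod 0)\<^sup>2 + 4 * (cmod \<sigma>)\<^sup>2)"
    using z by (simp add: real_sqrt_mult)
  ultimately obtain \<alpha> \<delta> where x: "norm (\<alpha> *\<^sub>C e\<^sub>1 + \<delta> *\<^sub>C e\<^sub>2) = 1"
    "cinner (B (\<alpha> *\<^sub>C e\<^sub>1 + \<delta> *\<^sub>C e\<^sub>2)) (\<alpha> *\<^sub>C e\<^sub>1 + \<delta> *\<^sub>C e\<^sub>2) = z"
    using triangular_block_numerical_range[OF B e1(3) e2(3) _ e1(1)] by blast
  have "\<alpha> *\<^sub>C e\<^sub>1 + \<delta> *\<^sub>C e\<^sub>2 \<in> perp F"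
    using e1(2) e2(2) by (simp add: perp_def cinner_simps)
  from F(2)[OF this] x(1) \<eta>(2) have "norm (L (\<alpha> *\<^sub>C e\<^sub>1 + \<delta> *\<^sub>C e\<^sub>2)) < \<epsilon>" by simp
  with x show "\<exists>x. norm x = 1 \<and> cinner (B x) x = z \<and> norm (L x) < \<epsilon>" by blast
qed

section \<open>Operators whose square is a scalar\<close>

text \<open>The one-sided results hold for parameters slightly larger or smaller than the essential norm
  \<open>s\<close>; passing to the limit uses that the essential numerical range is closed. In the case \<open>s = 0\<close>
  division by zero makes \<open>|\<sigma>|\<^sup>2 / s\<close> equal to \<open>0\<close>, and \<open>\<sigma> = 0\<close> follows from \<open>|\<sigma>| \<le> s\<close>.\<close>

lemma essential_numerical_range_square_scalar:
  fixes B :: "'a::complex_inner \<Rightarrow> 'a"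
  assumes B: "bounded_clinear B" and BB: "\<And>x. B (B x) = \<sigma>\<^sup>2 *\<^sub>C x"
    and inf: "infinite_dimensional {x. B x = \<sigma> *\<^sub>C x}" "infinite_dimensional {x. B x = (- \<sigma>) *\<^sub>C x}"
    and s: "s = essential_norm B"
  shows "essential_numerical_range B = {z. cmod (z - \<sigma>) + cmod (z + \<sigma>) \<le> s + (cmod \<sigma>)\<^sup>2 / s}"
    (is "_ = ?E")
proof
  have fs: "cmod \<sigma> \<le> s" using eigenvalue_le_essential_norm[OF B inf(1)] by (simp add: s)
  then have s0: "0 \<le> s" using norm_ge_zero order_trans by blast
  show "essential_numerical_range B \<subseteq> ?E"
  proof
    fix z assume z: "z \<in> essential_numerical_range B"
    define i where "i n = 1 / real (Suc n)" for n
    have "cmod (z - \<sigma>) + cmod (z + \<sigma>) \<le> (1 + i n) * (s + i n + (cmod \<sigma>)\<^sup>2 / s)" for n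
    proof -
      have i: "0 < i n" by (simp add: i_def)
      have "cmod (z - \<sigma>) + cmod (z + \<sigma>) \<le> (1 + i n) * (s + i n + (cmod \<sigma>)\<^sup>2 / (s + i n))"
        using i fs by (intro essential_numerical_range_focal_sum_le[OF B BB _ _ _ z])
          (auto simp: s[symmetric])
      also have "(cmod \<sigma>)\<^sup>2 / (s + i n) \<le> (cmod \<sigma>)\<^sup>2 / s"
      proof (cases "s = 0")
        case False
        then show ?thesis using s0 i by (intro divide_left_mono) auto
      qed (use fs in simp)
      finally show ?thesis using i by simp
    qed
    moreover have "(\<lambda>n. (1 + i n) * (s + i n + (cmod \<sigma>)\<^sup>2 / s))
        \<longlonglongrightarrow> (1 + 0) * (s + 0 + (cmod \<sigma>)\<^sup>2 / s)"
      unfolding i_def by (intro tendsto_intros LIMSEQ_Suc lim_1_over_n)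
    ultimately have "cmod (z - \<sigma>) + cmod (z + \<sigma>) \<le> (1 + 0) * (s + 0 + (cmod \<sigma>)\<^sup>2 / s)"
      by (intro LIMSEQ_le_const) auto
    then show "z \<in> ?E" by simp
  qed
  show "?E \<subseteq> essential_numerical_range B"
  proof
    fix z assume z: "z \<in> ?E"
    show "z \<in> essential_numerical_range B"
    proof (cases "cmod \<sigma> = s")
      case True
      then have "s + (cmod \<sigma>)\<^sup>2 / s = 2 * cmod \<sigma>" by (simp add: power2_eq_square)
      with z show ?thesis
        by (intro essential_numerical_range_contains_segment[OF B inf]) auto
    next
      case False
      define f where "f = cmod \<sigma>"
      have f: "0 \<le> f" "f < s" "0 < s"
        using False fs norm_ge_zero[of \<sigma>] by (auto simp: f_def simp del: norm_ge_zero)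
      define M where "M = s + f\<^sup>2 / s"
      have strict: "w \<in> essential_numerical_range B"
        if w: "cmod (w - \<sigma>) + cmod (w + \<sigma>) < M" for w
      proof -
        \<comment> \<open>Lowering \<open>s\<close> to \<open>s - \<delta>\<close> shrinks the major axis by at most \<open>\<delta>\<close>, because the quotient
          \<open>f\<^sup>2 / s\<close> only grows.\<close>
        define \<delta> where "\<delta> = min (M - (cmod (w - \<sigma>) + cmod (w + \<sigma>))) ((s - f) / 2)"
        have \<delta>: "0 < \<delta>" "\<delta> \<le> M - (cmod (w - \<sigma>) + cmod (w + \<sigma>))" "\<delta> \<le> (s - f) / 2"
        proof -
          show "0 < \<delta>" using w f by (simp add: \<delta>_def)
        qed (unfold \<delta>_def, rule min.cobounded1, rule min.cobounded2)
        have fd: "f < s - \<delta>" using \<delta>(3) f(2) by argo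
        have "0 < s * (s - \<delta>)" using fd f by (intro mult_pos_pos) linarith+
        then have "f\<^sup>2 / s \<le> f\<^sup>2 / (s - \<delta>)"
          using \<delta>(1) by (intro divide_left_mono) (simp_all add: mult.commute)
        then have "cmod (w - \<sigma>) + cmod (w + \<sigma>) \<le> (s - \<delta>) + f\<^sup>2 / (s - \<delta>)"
          using \<delta>(2) unfolding M_def by linarith
        then show ?thesis
          using fd \<delta>(1) unfolding f_def
          by (intro essential_numerical_range_contains_ellipse[OF B BB, where s = "s - \<delta>"])
            (simp_all add: s[symmetric])
      qed
      \<comment> \<open>The centre lies strictly inside the ellipse, so contracting \<open>z\<close> towards it makes the
        inequality strict.\<close>
      have "0 < (s - f)\<^sup>2 / s" using f by simp
      also have "(s - f)\<^sup>2 / s = M - 2 * f"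
        using f by (simp add: M_def field_simps power2_eq_square)
      finally have "2 * f < M" by simp
      define r where "r n = 1 - 1 / real (Suc n)" for n
      have "of_real (r n) * z \<in> essential_numerical_range B" for n
      proof (rule strict)
        have r: "0 \<le> r n" "r n < 1" by (auto simp: r_def)
        have "cmod (of_real (r n) * z - \<sigma>) + cmod (of_real (r n) * z + \<sigma>)
            \<le> r n * (cmod (z - \<sigma>) + cmod (z + \<sigma>)) + (1 - r n) * (2 * f)"
          using focal_sum_scale[of "r n" z \<sigma>] r by (simp add: f_def)
        also have "\<dots> \<le> r n * M + (1 - r n) * (2 * f)"
          using z r by (intro add_right_mono mult_left_mono) (auto simp: M_def f_def)
        also have "\<dots> < r n * M + (1 - r n) * M" using r \<open>2 * f < M\<close> by simp
        also have "\<dots> = M" by (simp add: algebra_simps)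
        finally show "cmod (of_real (r n) * z - \<sigma>) + cmod (of_real (r n) * z + \<sigma>) < M" .
      qed
      moreover have "(\<lambda>n. of_real (r n) * z) \<longlonglongrightarrow> of_real (1 - 0) * z"
        unfolding r_def by (intro tendsto_intros LIMSEQ_Suc lim_1_over_n)
      ultimately have "of_real (1 - 0) * z \<in> essential_numerical_range B"
        by (rule closed_sequentially[OF closed_essential_numerical_range])
      then show ?thesis by simp
    qed
  qed
qed

lemma essential_numerical_range_translate:
  "z \<in> essential_numerical_range A \<longleftrightarrow> z - \<mu> \<in> essential_numerical_range (\<lambda>x. A x - \<mu> *\<^sub>C x)"
proof -
  have "closure (numerical_range (\<lambda>x. A x + K x))
      = (\<lambda>w. \<mu> + w) ` closure (numerical_range (\<lambda>x. A x - \<mu> *\<^sub>C x + K x))" for K :: "'a \<Rightarrow> 'a"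
  proof -
    have "cinner (A x + K x) x = \<mu> + cinner (A x - \<mu> *\<^sub>C x + K x) x" if "norm x = 1" for x
      using that by (simp add: cinner_simps cinner_self)
    then have "numerical_range (\<lambda>x. A x + K x)
        = (\<lambda>w. \<mu> + w) ` numerical_range (\<lambda>x. A x - \<mu> *\<^sub>C x + K x)"
      unfolding numerical_range_def by force
    then show ?thesis by (simp only: closure_translation)
  qed
  moreover have "z \<in> (\<lambda>w. \<mu> + w) ` S \<longleftrightarrow> z - \<mu> \<in> S" for S
    by (auto simp: image_iff) (metis add_diff_cancel_left' diff_add_cancel add.commute)
  ultimately show ?thesis by (simp add: essential_numerical_range_def)
qed

theorem theorem2p2:
  fixes A :: "'a::chilbert_space \<Rightarrow> 'a"
    and \<mu> \<nu> l\<^sub>1 l\<^sub>2 :: complex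
    and s\<^sub>0 t\<^sub>0 :: real
  assumes "infinite_dimensional (UNIV :: 'a set)"
    and "bounded_clinear A"
    and "\<And>x. A (A x) - (2 * \<mu>) *\<^sub>C A x - \<nu> *\<^sub>C x = 0"
    and "l\<^sub>1 = \<mu> + csqrt (\<mu>\<^sup>2 + \<nu>)"
    and "l\<^sub>2 = \<mu> - csqrt (\<mu>\<^sup>2 + \<nu>)"
    and "infinite_dimensional (eigenspace A l\<^sub>1)"
    and "infinite_dimensional (eigenspace A l\<^sub>2)"
    and "s\<^sub>0 = essential_norm (\<lambda>x. A x - \<mu> *\<^sub>C x)"
    and "t\<^sub>0 = (if s\<^sub>0 = 0 then 0 else cmod (\<mu>\<^sup>2 + \<nu>) * inverse s\<^sub>0)"
  shows "is_elliptical_disc (essential_numerical_range A) l\<^sub>1 l\<^sub>2 (s\<^sub>0 + t\<^sub>0) (s\<^sub>0 - t\<^sub>0)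
    \<and> (s\<^sub>0 = 0 \<longrightarrow> \<mu>\<^sup>2 + \<nu> = 0)"
proof -
  define \<sigma> where "\<sigma> = csqrt (\<mu>\<^sup>2 + \<nu>)"
  define B where "B x = A x - \<mu> *\<^sub>C x" for x
  have \<sigma>2: "\<sigma>\<^sup>2 = \<mu>\<^sup>2 + \<nu>" by (simp add: \<sigma>_def)
  then have f2: "(cmod \<sigma>)\<^sup>2 = cmod (\<mu>\<^sup>2 + \<nu>)" by (metis norm_power)
  have B: "bounded_clinear B"
    unfolding B_def[abs_def] by (rule bounded_clinear_minus_scaleC[OF assms(2)])
  have BB: "B (B x) = \<sigma>\<^sup>2 *\<^sub>C x" for x
  proof -
    have AA: "A (A x) = (2 * \<mu>) *\<^sub>C A x + \<nu> *\<^sub>C x" using assms(3)[of x] by (simp add: algebra_simps)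
    have "B (B x) = A (A x) - \<mu> *\<^sub>C A x - (\<mu> *\<^sub>C A x - (\<mu> * \<mu>) *\<^sub>C x)"
      by (simp add: B_def bounded_clinear_diff[OF assms(2)] bounded_clinear_scaleC[OF assms(2)]
          scaleC_scaleC complex_vector.scale_right_diff_distrib)
    also have "\<dots> = (\<mu> * \<mu>) *\<^sub>C x + \<nu> *\<^sub>C x"
    proof -
      have "(2 * \<mu>) *\<^sub>C A x = \<mu> *\<^sub>C A x + \<mu> *\<^sub>C A x"
        unfolding mult_2 by (rule scaleC_add_left)
      then show ?thesis unfolding AA by simp
    qed
    finally show ?thesis by (simp only: \<sigma>2 scaleC_add_left) (simp add: power2_eq_square)
  qed
  have "eigenspace A (\<mu> + c) = {x. B x = c *\<^sub>C x}" for c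
    by (auto simp: eigenspace_def B_def scaleC_add_left algebra_simps)
  from this[of \<sigma>] this[of "- \<sigma>"]
  have inf: "infinite_dimensional {x. B x = \<sigma> *\<^sub>C x}" "infinite_dimensional {x. B x = (- \<sigma>) *\<^sub>C x}"
    using assms(4-7) by (simp_all add: \<sigma>_def)
  have s0: "s\<^sub>0 = essential_norm B" using assms(8) by (simp add: B_def[abs_def])
  have fs: "cmod \<sigma> \<le> s\<^sub>0" using eigenvalue_le_essential_norm[OF B inf(1)] by (simp add: s0)
  then have s0_nonneg: "0 \<le> s\<^sub>0" using norm_ge_zero order_trans by blast
  have t0: "t\<^sub>0 = (cmod \<sigma>)\<^sup>2 / s\<^sub>0" using assms(9) f2 by (simp add: divide_inverse)
  have fs2: "(cmod \<sigma>)\<^sup>2 \<le> s\<^sub>0\<^sup>2" using fs by (intro power_mono) auto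
  have st: "s\<^sub>0 * t\<^sub>0 = (cmod \<sigma>)\<^sup>2" using fs by (cases "s\<^sub>0 = 0") (auto simp: t0)
  have l: "l\<^sub>1 = \<mu> + \<sigma>" "l\<^sub>2 = \<mu> - \<sigma>" using assms(4,5) by (simp_all add: \<sigma>_def)
  have "dist l\<^sub>1 l\<^sub>2 = cmod (2 * \<sigma>)" by (simp add: l dist_norm)
  then have foci: "(dist l\<^sub>1 l\<^sub>2)\<^sup>2 = 4 * (s\<^sub>0 * t\<^sub>0)" by (simp add: norm_mult st power_mult_distrib)
  have "t\<^sub>0 \<le> s\<^sub>0"
    using s0_nonneg fs2 by (cases "s\<^sub>0 = 0") (auto simp: t0 field_simps power2_eq_square)
  moreover have "0 \<le> t\<^sub>0" using s0_nonneg by (simp add: t0)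
  moreover have "(s\<^sub>0 + t\<^sub>0)\<^sup>2 = (s\<^sub>0 - t\<^sub>0)\<^sup>2 + (dist l\<^sub>1 l\<^sub>2)\<^sup>2"
    unfolding foci by (simp add: power2_eq_square algebra_simps)
  moreover have "essential_numerical_range A = {z. dist z l\<^sub>1 + dist z l\<^sub>2 \<le> s\<^sub>0 + t\<^sub>0}"
  proof -
    have "z \<in> essential_numerical_range A \<longleftrightarrow>
        cmod (z - \<mu> - \<sigma>) + cmod (z - \<mu> + \<sigma>) \<le> s\<^sub>0 + t\<^sub>0" for z
      using essential_numerical_range_translate[of z A \<mu>]
        essential_numerical_range_square_scalar[OF B BB inf s0]
      by (simp add: B_def[abs_def] t0)
    then show ?thesis by (auto simp: l dist_norm algebra_simps)
  qed
  ultimately show ?thesis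
    using s0_nonneg fs \<sigma>2 by (auto simp: is_elliptical_disc_def)
qed

end
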